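(* Let $(\phi_t)$ be a parabolic semigroup of zero hyperbolic step in $\mathbb{D}$ whose Koenigs domain $\Omega$ satisfies $\Omega\subseteq\mathbb{C}\setminus\{-t:t\ge0\}$, and let $(T_t)$ be the induced semigroup of composition operators. Let $p\ge1$, $\alpha>-1$, and let $\sigma_{p,\alpha}$ be the point spectrum of the infinitesimal generator of $(T_t)$ acting on the Bergman space $A^p_\alpha$. With $\theta_\Omega^\pm,\Theta_\Omega^\pm$ the upper/lower inner and outer arguments, and $\theta_\Omega=\theta_\Omega^-+\theta_\Omega^+$, $\Theta_\Omega=\Theta_\Omega^-+\Theta_\Omega^+$, the following hold: (a) If $\theta_\Omega=\Theta_\Omega=0$, then $iS(0,\pi)\cup\{0\}\subseteq\sigma_{p,\alpha}\subseteq i\overline{S(0,\pi)}$. (b) If $\theta_\Omega=\Theta_\Omega\in(0,\pi)$ (and hence $\theta_\Omega^-=\Theta_\Omega^-$, $\theta_\Omega^+=\Theta_\Omega^+$), then $iS(\theta_\Omega^-,\pi-\theta_\Omega^+)\cup\{0\}\subseteq\sigma_{p,\alpha}\subseteq i\overline{S(\theta_\Omega^-,\pi-\theta_\Omega^+)}$. (c) If $\theta_\Omega=\pi$, then $\sigma_{p,\alpha}\subseteq\{ie^{i\theta_\Omega^-}t:t\ge0\}$. (d) If $\theta_\Omega\in(\pi,2\pi]$, then $\sigma_{p,\alpha}=\{0\}$. (e) If $\theta_\Omega<\min\{\pi,\Theta_\Omega\}$, then $iS(\Theta_\Omega^-,\pi-\Theta_\Omega^+)\cup\{0\}\subseteq\sigma_{p,\alpha}\subseteq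 i\overline{S(\theta_\Omega^-,\pi-\theta_\Omega^+)}$, where in case $\Theta_\Omega\ge\pi$ the set on the left is replaced by $\{0\}$, and in case $\theta_\Omega=0$ the set on the right is $i\overline{S(0,\pi)}$. Moreover, all the same results hold with $\sigma_{p,\alpha}$ replaced by the point spectrum $\sigma_p$ of the infinitesimal generator of $(T_t)$ acting on the Hardy space $H^p$, $p\ge1$.
   Context: $\mathbb{D}$ is the open unit disk. A semigroup in $\mathbb{D}$ is a family $(\phi_t)_{t\ge0}$ of holomorphic maps $\phi_t:\mathbb{D}\to\mathbb{D}$ with $\phi_0=\mathrm{id}$, $\phi_{t+s}=\phi_t\circ\phi_s$ for all $t,s\ge0$, and $\phi_t(z)\to z$ uniformly on compacta as $t\to0^+$. It is non-elliptic if there is $\tau\in\partial\mathbb{D}$ (the Denjoy–Wolff point) with $\phi_t(z)\to\tau$ as $t\to+\infty$ for all $z\in\mathbb{D}$; a non-elliptic semigroup is parabolic if the angular derivative satisfies $\phi_1'(\tau)=1$. For a non-elliptic semigroup there is a univalent map $h:\mathbb{D}\to\mathbb{C}$, unique up to translation, the Koenigs function, with $h(\phi_t(z))=h(z)+t$ for all $t\ge0$, $z\in\mathbb{D}$; $\Omega:=h(\mathbb{D})$ is the Koenigs domain. A parabolic semigroup is of zero hyperbolic step if $\Omega$ is not contained in any horizontal half-plane $\{\mathrm{Im}\,w>c\}$ or $\{\mathrm{Im}\,w<c\}$. For $a<b$ in $[-\pi,\pi]$: $S(a,b)=\{w\in\mathbb{C}:a<\arg w<b\}$, and $\overline{S(a,b)}$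 is its topological closure in $\mathbb{C}$; $iE=\{iw:w\in E\}$. Put $\Omega^-=\Omega\cap S(-\pi,0)$ and $\Omega^+=\Omega\cap S(0,\pi)$ (both non-empty and connected). Define $\theta_\Omega^-=\sup(\{0\}\cup\{\theta\in(0,\pi]:\exists\,q_\theta\in\mathbb{C}\text{ with }q_\theta+S(-\theta,0)\subseteq\Omega^-\})$, $\Theta_\Omega^-=\inf\{\theta\in(0,\pi]:\exists\,q_\theta\in\mathbb{C}\text{ with }\Omega^-\subseteq q_\theta+S(-\theta,0)\}$, $\theta_\Omega^+=\sup(\{0\}\cup\{\theta\in(0,\pi]:\exists\,q_\theta\in\mathbb{C}\text{ with }q_\theta+S(0,\theta)\subseteq\Omega^+\})$, $\Theta_\Omega^+=\inf\{\theta\in(0,\pi]:\exists\,q_\theta\in\mathbb{C}\text{ with }\Omega^+\subseteq q_\theta+S(0,\theta)\}$ (lower inner, lower outer, upper inner, upper outer arguments). $A^p_\alpha$ is the Banach space of holomorphic $f$ on $\mathbb{D}$ with $\|f\|^p_{A^p_\alpha}=\int_{\mathbb{D}}|f(z)|^p(1-|z|^2)^\alpha\,dA(z)<+\infty$ ($dA$ normalized area measure); $H^p$ is the Banach space of holomorphic $f$ on $\mathbb{D}$ with $\|f\|_{H^p}^p=\sup_{0\le r<1}\int_0^{2\pi}|f(re^{i\theta})|^p\,d\theta<+\infty$. On $X=A^p_\alpha$ or $H^p$, $T_t(f)=f\circ\phi_t$ is a strongly continuous semigroup of bounded operators; its infinitesimal generator is $\Gamma_X(f)=\lim_{t\to0^+}(T_t(f)-f)/t$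 (norm limit), defined on those $f\in X$ for which the limit exists in $X$. The point spectrum is the set of eigenvalues $\lambda\in\mathbb{C}$ of $\Gamma_X$. *)

theory Defs
  imports "HOL-Complex_Analysis.Complex_Analysis"
begin

section \<open>Semigroups of holomorphic self-maps of the unit disk\<close>

abbreviation unit_disk :: "complex set" where
  "unit_disk \<equiv> ball 0 1"

definition holomorphic_semigroup :: "(real \<Rightarrow> complex \<Rightarrow> complex) \<Rightarrow> bool" where
  "holomorphic_semigroup \<phi> \<longleftrightarrow>
     (\<forall>t\<ge>0. \<phi> t holomorphic_on unit_disk \<and> \<phi> t ` unit_disk \<subseteq> unit_disk) \<and>
     (\<forall>z\<in>unit_disk. \<phi> 0 z = z) \<and>
     (\<forall>t\<ge>0. \<forall>s\<ge>0. \<forall>z\<in>unit_disk. \<phi> (t + s) z = \<phi> t (\<phi> s z)) \<and>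
     (\<forall>K. compact K \<and> K \<subseteq> unit_disk \<longrightarrow> uniform_limit K \<phi> (\<lambda>z. z) (at_right 0))"

definition denjoy_wolff_point :: "(real \<Rightarrow> complex \<Rightarrow> complex) \<Rightarrow> complex \<Rightarrow> bool" where
  "denjoy_wolff_point \<phi> \<tau> \<longleftrightarrow>
     \<tau> \<in> sphere 0 1 \<and> (\<forall>z\<in>unit_disk. ((\<lambda>t. \<phi> t z) \<longlongrightarrow> \<tau>) at_top)"

definition nonelliptic_semigroup :: "(real \<Rightarrow> complex \<Rightarrow> complex) \<Rightarrow> bool" where
  "nonelliptic_semigroup \<phi> \<longleftrightarrow>
     holomorphic_semigroup \<phi> \<and> (\<exists>\<tau>. denjoy_wolff_point \<phi> \<tau>)"

definition stolz_region :: "complex \<Rightarrow> real \<Rightarrow> complex set" where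
  "stolz_region \<tau> M = {z \<in> unit_disk. cmod (\<tau> - z) < M * (1 - cmod z)}"

definition has_angular_limit ::
    "(complex \<Rightarrow> complex) \<Rightarrow> complex \<Rightarrow> complex \<Rightarrow> bool" where
  "has_angular_limit f \<tau> l \<longleftrightarrow> (\<forall>M>1. (f \<longlongrightarrow> l) (at \<tau> within stolz_region \<tau> M))"

text \<open>The boundary value of \<open>f\<close> at \<open>\<tau>\<close> is its angular limit there; the value that the total
  function \<open>f\<close> happens to take at \<open>\<tau>\<close> is irrelevant.\<close>

definition has_angular_derivative ::
    "(complex \<Rightarrow> complex) \<Rightarrow> complex \<Rightarrow> complex \<Rightarrow> bool" where
  "has_angular_derivative f \<tau> d \<longleftrightarrow>
     (\<exists>\<eta>. has_angular_limit f \<tau> \<eta> \<and> has_angular_limit (\<lambda>z. (f z - \<eta>) / (z - \<tau>)) \<tau> d)"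

definition parabolic_semigroup :: "(real \<Rightarrow> complex \<Rightarrow> complex) \<Rightarrow> bool" where
  "parabolic_semigroup \<phi> \<longleftrightarrow>
     nonelliptic_semigroup \<phi> \<and>
     (\<exists>\<tau>. denjoy_wolff_point \<phi> \<tau> \<and> has_angular_derivative (\<phi> 1) \<tau> 1)"

definition koenigs_function ::
    "(real \<Rightarrow> complex \<Rightarrow> complex) \<Rightarrow> (complex \<Rightarrow> complex) \<Rightarrow> bool" where
  "koenigs_function \<phi> h \<longleftrightarrow>
     h holomorphic_on unit_disk \<and> inj_on h unit_disk \<and>
     (\<forall>t\<ge>0. \<forall>z\<in>unit_disk. h (\<phi> t z) = h z + of_real t)"

text \<open>A property of the Koenigs domain \<open>\<Omega>\<close>; it is invariant under translation, hence independent of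
  the choice of the Koenigs function.\<close>

definition zero_hyperbolic_step :: "complex set \<Rightarrow> bool" where
  "zero_hyperbolic_step \<Omega> \<longleftrightarrow>
     (\<forall>c. \<not> \<Omega> \<subseteq> {w. Im w > c} \<and> \<not> \<Omega> \<subseteq> {w. Im w < c})"


section \<open>Sectors and the inner and outer arguments\<close>

text \<open>\<open>Arg\<close> takes values in \<open>(-pi, pi]\<close>. The library sets \<open>Arg 0 = 0\<close>, so the vertex must be
  excluded explicitly.\<close>

definition sector :: "real \<Rightarrow> real \<Rightarrow> complex set" where
  "sector a b = {w. w \<noteq> 0 \<and> a < Arg w \<and> Arg w < b}"

definition lower_part :: "complex set \<Rightarrow> complex set" where
  "lower_part \<Omega> = \<Omega> \<inter> sector (- pi) 0"

definition upper_part :: "complex set \<Rightarrow> complex set" where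
  "upper_part \<Omega> = \<Omega> \<inter> sector 0 pi"

definition lower_inner_arg :: "complex set \<Rightarrow> real" where
  "lower_inner_arg \<Omega> =
     Sup ({0} \<union> {\<theta> \<in> {0<..pi}. \<exists>q. (+) q ` sector (- \<theta>) 0 \<subseteq> lower_part \<Omega>})"

definition lower_outer_arg :: "complex set \<Rightarrow> real" where
  "lower_outer_arg \<Omega> =
     Inf {\<theta> \<in> {0<..pi}. \<exists>q. lower_part \<Omega> \<subseteq> (+) q ` sector (- \<theta>) 0}"

definition upper_inner_arg :: "complex set \<Rightarrow> real" where
  "upper_inner_arg \<Omega> =
     Sup ({0} \<union> {\<theta> \<in> {0<..pi}. \<exists>q. (+) q ` sector 0 \<theta> \<subseteq> upper_part \<Omega>})"

definition upper_outer_arg :: "complex set \<Rightarrow> real" where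
  "upper_outer_arg \<Omega> =
     Inf {\<theta> \<in> {0<..pi}. \<exists>q. upper_part \<Omega> \<subseteq> (+) q ` sector 0 \<theta>}"

definition inner_arg :: "complex set \<Rightarrow> real" where
  "inner_arg \<Omega> = lower_inner_arg \<Omega> + upper_inner_arg \<Omega>"

definition outer_arg :: "complex set \<Rightarrow> real" where
  "outer_arg \<Omega> = lower_outer_arg \<Omega> + upper_outer_arg \<Omega>"


section \<open>Bergman and Hardy spaces\<close>

text \<open>Elements of the spaces are total functions of which only the restriction to the disk matters;
  the norms below ignore all other values. The factor \<open>1 / pi\<close> normalizes the area measure.\<close>

definition bergman_space :: "real \<Rightarrow> real \<Rightarrow> (complex \<Rightarrow> complex) set" where
  "bergman_space p \<alpha> =
     {f. f holomorphic_on unit_disk \<and>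
         set_integrable lborel unit_disk (\<lambda>z. cmod (f z) powr p * (1 - (cmod z)\<^sup>2) powr \<alpha>)}"

definition bergman_norm :: "real \<Rightarrow> real \<Rightarrow> (complex \<Rightarrow> complex) \<Rightarrow> real" where
  "bergman_norm p \<alpha> f =
     (1 / pi * (LINT z:unit_disk|lborel. cmod (f z) powr p * (1 - (cmod z)\<^sup>2) powr \<alpha>))
       powr (1 / p)"

definition hardy_mean :: "real \<Rightarrow> (complex \<Rightarrow> complex) \<Rightarrow> real \<Rightarrow> real" where
  "hardy_mean p f r = (LINT \<theta>:{0..2 * pi}|lborel. cmod (f (of_real r * cis \<theta>)) powr p)"

definition hardy_space :: "real \<Rightarrow> (complex \<Rightarrow> complex) set" where
  "hardy_space p = {f. f holomorphic_on unit_disk \<and> bdd_above (hardy_mean p f ` {0..<1})}"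

definition hardy_norm :: "real \<Rightarrow> (complex \<Rightarrow> complex) \<Rightarrow> real" where
  "hardy_norm p f = (SUP r\<in>{0..<1}. hardy_mean p f r) powr (1 / p)"


section \<open>Generator of the composition semigroup and its point spectrum\<close>

text \<open>\<open>has_generator_value X N \<phi> f g\<close>: in the function space \<open>X\<close> with norm \<open>N\<close>, the function \<open>f\<close> is in
  the domain of the generator of \<open>f \<mapsto> f \<circ> \<phi>\<^sub>t\<close> and is mapped to \<open>g\<close>. The limit is one of elements
  of \<open>X\<close>, so the difference quotients are required to lie in \<open>X\<close>; this is automatic when the
  composition operators act on \<open>X\<close>, as they do on Bergman and Hardy spaces, and it avoids evaluating
  \<open>N\<close> outside \<open>X\<close>, where it is meaningless.\<close>

definition has_generator_value ::
    "(complex \<Rightarrow> complex) set \<Rightarrow> ((complex \<Rightarrow> complex) \<Rightarrow> real) \<Rightarrow>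
     (real \<Rightarrow> complex \<Rightarrow> complex) \<Rightarrow> (complex \<Rightarrow> complex) \<Rightarrow> (complex \<Rightarrow> complex) \<Rightarrow> bool" where
  "has_generator_value X N \<phi> f g \<longleftrightarrow>
     f \<in> X \<and> g \<in> X \<and>
     (\<forall>t>0. (\<lambda>z. (f (\<phi> t z) - f z) / of_real t) \<in> X) \<and>
     ((\<lambda>t. N (\<lambda>z. (f (\<phi> t z) - f z) / of_real t - g z)) \<longlongrightarrow> 0) (at_right 0)"

definition generator_point_spectrum ::
    "(complex \<Rightarrow> complex) set \<Rightarrow> ((complex \<Rightarrow> complex) \<Rightarrow> real) \<Rightarrow>
     (real \<Rightarrow> complex \<Rightarrow> complex) \<Rightarrow> complex set" where
  "generator_point_spectrum X N \<phi> =
     {\<mu>. \<exists>f. (\<exists>z\<in>unit_disk. f z \<noteq> 0) \<and> has_generator_value X N \<phi> f (\<lambda>z. \<mu> * f z)}"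

definition bergman_point_spectrum ::
    "real \<Rightarrow> real \<Rightarrow> (real \<Rightarrow> complex \<Rightarrow> complex) \<Rightarrow> complex set" where
  "bergman_point_spectrum p \<alpha> \<phi> =
     generator_point_spectrum (bergman_space p \<alpha>) (bergman_norm p \<alpha>) \<phi>"

definition hardy_point_spectrum ::
    "real \<Rightarrow> (real \<Rightarrow> complex \<Rightarrow> complex) \<Rightarrow> complex set" where
  "hardy_point_spectrum p \<phi> = generator_point_spectrum (hardy_space p) (hardy_norm p) \<phi>"

end

theory Submission
  imports Defs
begin

text \<open>
  The Koenigs function turns the semigroup into translation: if \<open>f\<close> is an eigenfunction of the
  generator with eigenvalue \<open>\<mu>\<close>, then \<open>F = f \<circ> h\<inverse>\<close> is holomorphic on \<open>\<Omega>\<close> and differentiating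
  \<open>F (w + t)\<close> in \<open>t\<close> gives \<open>F' = \<mu> F\<close>, so \<open>F\<close> is a multiple of \<open>exp (\<mu> w)\<close>. Hence the point spectrum
  consists of exactly those \<open>\<mu>\<close> for which \<open>exp (\<mu> h)\<close> belongs to the function space
  (\<open>point_spectrum_iff\<close>). This argument, and everything after it, needs only a few properties of
  Bergman and Hardy spaces, collected in the locale \<open>disk_function_space\<close>: they are vector spaces
  that contain the bounded holomorphic functions, and the values of a function of norm at most one
  grow at most like a fixed power of \<open>1 / (1 - \<bar>z\<bar>\<^sup>2)\<close>.

  The inner inclusions hold because \<open>exp (\<mu> h)\<close> is then bounded: if \<open>\<Omega>\<close> lies above and below the real
  axis in translates of sectors whose directions \<open>v\<close> satisfy \<open>Re (\<mu> v) \<le> 0\<close>, then \<open>Re (\<mu> w)\<close> is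
  bounded above on \<open>\<Omega>\<close> (\<open>point_spectrum_contains\<close>).

  The outer inclusions all come from one principle (\<open>spectrum_direction_le\<close>): if \<open>\<Omega>\<close> contains, for
  every radius \<open>R\<close>, the discs of radius \<open>R\<close> about all sufficiently distant points of a ray with
  direction \<open>v\<close>, then \<open>Re (\<mu> v) \<le> 0\<close> for every eigenvalue \<open>\<mu>\<close>. Indeed the Schwarz-Pick lemma on
  those discs shows that \<open>1 - \<bar>h\<inverse>\<bar>\<^sup>2\<close> decays along the ray no faster than \<open>exp (- 2 s / R)\<close>, so that
  functions of the space, composed with \<open>h\<inverse>\<close>, grow along the ray with an exponential rate that is as
  small as we please, whereas \<open>exp (\<mu> w)\<close> grows with rate \<open>Re (\<mu> v)\<close>. Zero hyperbolic step makes
  \<open>v = 1\<close> such a direction, since \<open>\<Omega>\<close> then contains half-strips of every width; a translated sector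
  inside \<open>\<Omega>\<close> contributes all directions in its interior. Letting the opening of the sector tend to the inner
  argument confines \<open>arg (\<mu> / i)\<close> to the interval between the lower inner argument and \<open>\<pi>\<close> minus the
  upper inner argument (\<open>point_spectrum_arg_bounds\<close>). This interval is nondegenerate, a point, or
  empty according to whether the sum of the inner arguments is less than, equal to, or greater than
  \<open>\<pi>\<close>.
\<close>

section \<open>Mean values over circles and discs\<close>

text \<open>Cauchy's formula on the unit circle, with \<open>\<bar>\<zeta> - z\<bar> \<ge> 1 - \<bar>z\<bar>\<close> in the denominator. The factor
  \<open>1 - \<bar>z\<bar>\<close> is what yields polynomial growth in Hardy spaces.\<close>

lemma circle_mean_bound:
  assumes cont: "continuous_on (cball 0 1) F" and holo: "F holomorphic_on unit_disk" and z: "cmod z < 1"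
  shows "2 * pi * (1 - cmod z) * cmod (F z) \<le> (LINT \<theta>:{0..2 * pi}|lborel. cmod (F (cis \<theta>)))"
proof -
  define I where "I = 2 * of_real pi * \<i> * F z"
  define k where "k = (\<lambda>\<theta>. F (cis \<theta>) / (cis \<theta> - z) * (\<i> * cis \<theta>))"
  have den: "1 - cmod z \<le> cmod (cis \<theta> - z)" for \<theta>
    using norm_triangle_ineq2[of "cis \<theta>" z] by simp
  have contF: "continuous_on {0..2*pi} (\<lambda>\<theta>. F (cis \<theta>))"
    by (rule continuous_on_compose2[OF cont]) (auto intro!: continuous_intros)
  have "((\<lambda>u. F u / (u - z)) has_contour_integral I) (circlepath 0 1)"
    unfolding I_def using Cauchy_integral_circlepath[of 0 1 F z] cont holo z by auto
  hence "(k has_integral I) {0..2 * pi}"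
    unfolding circlepath_def k_def
    by (subst (asm) has_contour_integral_part_circlepath_iff) (auto simp: mult_ac)
  moreover have "((\<lambda>\<theta>. cmod (F (cis \<theta>))) has_integral (LINT \<theta>:{0..2 * pi}|lborel. cmod (F (cis \<theta>)))) {0..2*pi}"
  proof -
    have "set_integrable lborel {0..2*pi} (\<lambda>\<theta>. cmod (F (cis \<theta>)))"
      by (intro borel_integrable_atLeastAtMost' continuous_on_norm contF)
    from set_borel_integral_eq_integral[OF this] show ?thesis
      by (simp add: has_integral_integral)
  qed
  hence "((\<lambda>\<theta>. cmod (F (cis \<theta>)) / (1 - cmod z)) has_integral
      (LINT \<theta>:{0..2 * pi}|lborel. cmod (F (cis \<theta>))) / (1 - cmod z)) {0..2*pi}"
    by (rule has_integral_divide)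
  moreover have "norm (k \<theta>) \<le> cmod (F (cis \<theta>)) / (1 - cmod z)" for \<theta>
    unfolding k_def norm_mult norm_divide using den[of \<theta>] z
    by (simp add: frac_le)
  ultimately have "norm I \<le> (LINT \<theta>:{0..2 * pi}|lborel. cmod (F (cis \<theta>))) / (1 - cmod z)"
    by (metis (no_types, lifting) has_integral_integrable_integral integral_norm_bound_integral)
  thus ?thesis using z by (simp add: I_def norm_mult field_simps)
qed

text \<open>The area mean value bound below averages circle means over a disc, which needs Lebesgue measure
  on the complex plane to be invariant under rotations. For \<open>real^2\<close> this is the invariance under
  orthogonal transformations; the coordinate map carries it over to the complex plane.\<close>

(* The same infix symbol denotes vector components below. *)
no_notation fps_nth (infixl "$" 75)

definition complex_of_vec2 :: "real^2 \<Rightarrow> complex" where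
  "complex_of_vec2 v = Complex (v$1) (v$2)"

lemma continuous_complex_of_vec2: "continuous_on A complex_of_vec2"
  unfolding complex_of_vec2_def Complex_eq by (intro continuous_intros)

lemma measurable_complex_of_vec2 [measurable]: "complex_of_vec2 \<in> borel_measurable borel"
  by (intro borel_measurable_continuous_onI continuous_complex_of_vec2)

lemma complex_of_vec2_vimage_box:
  "complex_of_vec2 -` box l u = box (vector [Re l, Im l]) (vector [Re u, Im u])"
  by (auto simp: complex_of_vec2_def mem_box_cart forall_2 in_box_complex_iff)

lemma distr_complex_of_vec2: "distr lborel borel complex_of_vec2 = lborel"
proof -
  have "lborel = distr lborel borel complex_of_vec2"
  proof (rule lborel_eqI)
    fix l u :: complex
    assume le: "\<And>b. b \<in> Basis \<Longrightarrow> l \<bullet> b \<le> u \<bullet> b"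
    have "Re l \<le> Re u" "Im l \<le> Im u"
      using le[of 1] le[of \<i>] by (simp_all add: Basis_complex_def)
    thus "emeasure (distr lborel borel complex_of_vec2) (box l u) = (\<Prod>b\<in>Basis. (u - l) \<bullet> b)"
      by (simp add: emeasure_distr complex_of_vec2_vimage_box emeasure_lborel_box_eq
        Basis_complex_def Basis_vec_def UNIV_2 inner_axis axis_eq_axis mult.commute)
  qed simp
  thus ?thesis ..
qed

lemma emeasure_lborel_complex:
  "A \<in> sets borel \<Longrightarrow> emeasure lborel A = emeasure lborel (complex_of_vec2 -` A)"
  using arg_cong[OF distr_complex_of_vec2, of "\<lambda>M. emeasure M A"] by (simp add: emeasure_distr)

lemma emeasure_orthogonal_vimage_box:
  assumes "orthogonal_transformation (R :: real^'n::{finite,wellorder} \<Rightarrow> real^'n::_)"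
  shows "emeasure lborel (R -` box l u) = emeasure lborel (box l u)"
proof -
  have inv: "orthogonal_transformation (inv R)"
    by (rule orthogonal_transformation_inv) fact
  have bij: "bij R" by (rule orthogonal_transformation_bij) fact
  have img: "R -` box l u = inv R ` box l u"
    by (rule bij_vimage_eq_inv_image[OF bij])
  have "continuous_on UNIV R"
    using assms by (simp add: linear_continuous_on orthogonal_transformation_linear linear_linear)
  hence op: "open (R -` box l u)" by (intro open_vimage) auto
  have lm: "box l u \<in> lmeasurable" by simp
  have "emeasure lborel (R -` box l u) = emeasure lebesgue (inv R ` box l u)"
    using op unfolding img by simp
  also have "\<dots> = ennreal (measure lebesgue (box l u))"
    using measurable_orthogonal_image[OF inv lm] measure_orthogonal_image[OF inv lm]
    by (simp add: emeasure_eq_measure2)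
  also have "\<dots> = emeasure lborel (box l u)"
    using lm by (simp add: emeasure_eq_measure2)
  finally show ?thesis .
qed

lemma lborel_rotate:
  assumes "cmod u = 1"
  shows "distr lborel borel (\<lambda>z. u * z) = (lborel :: complex measure)"
proof -
  define R :: "real^2 \<Rightarrow> real^2"
    where "R v = vector [Re u * v$1 - Im u * v$2, Re u * v$2 + Im u * v$1]" for v
  have u2: "(Re u)\<^sup>2 + (Im u)\<^sup>2 = 1"
    using assms cmod_power2[of u] by simp
  have "linear R"
    by (rule linearI) (simp_all add: R_def vec_eq_iff forall_2 algebra_simps)
  moreover have "norm (R v) = norm v" for v
  proof -
    have "(Re u * v$1 - Im u * v$2)\<^sup>2 + (Re u * v$2 + Im u * v$1)\<^sup>2
        = ((Re u)\<^sup>2 + (Im u)\<^sup>2) * ((v$1)\<^sup>2 + (v$2)\<^sup>2)"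
      by (simp add: power2_eq_square algebra_simps)
    thus ?thesis by (simp add: norm_vec_def L2_set_def sum_2 R_def u2)
  qed
  ultimately have orth: "orthogonal_transformation R"
    by (simp add: orthogonal_transformation)
  have conj: "complex_of_vec2 (R v) = u * complex_of_vec2 v" for v
    by (simp add: complex_of_vec2_def R_def complex_eq_iff)
  have "lborel = distr lborel borel (\<lambda>z. u * z)"
  proof (rule lborel_eqI)
    fix l r :: complex
    let ?V = "(\<lambda>z. u * z) -` box l r"
    have opV: "open ?V" by (intro open_vimage continuous_intros) auto
    have "emeasure lborel ?V = emeasure lborel (complex_of_vec2 -` ?V)"
      using opV by (intro emeasure_lborel_complex) simp
    also have "complex_of_vec2 -` ?V = R -` (complex_of_vec2 -` box l r)"
      by (auto simp: conj)
    also have "emeasure lborel \<dots> = emeasure lborel (complex_of_vec2 -` box l r)"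
      unfolding complex_of_vec2_vimage_box by (rule emeasure_orthogonal_vimage_box[OF orth])
    also have "\<dots> = emeasure lborel (box l r)"
      by (rule emeasure_lborel_complex[symmetric]) simp
    finally have "emeasure (distr lborel borel (\<lambda>z. u * z)) (box l r) = emeasure lborel (box l r)"
      by (subst emeasure_distr) auto
    thus "emeasure (distr lborel borel (\<lambda>z. u * z)) (box l r) = (\<Prod>b\<in>Basis. (r - l) \<bullet> b)"
      if "\<And>b. b \<in> Basis \<Longrightarrow> l \<bullet> b \<le> r \<bullet> b"
      using that by simp
  qed simp
  thus ?thesis ..
qed

lemma emeasure_complex_ball: "r \<ge> 0 \<Longrightarrow> emeasure lborel (ball (c::complex) r) = ennreal (pi * r\<^sup>2)"
  by (simp add: emeasure_ball unit_ball_vol_2)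

text \<open>For \<open>w\<close> in the disc of radius \<open>r\<close> about \<open>0\<close>, the value at \<open>c\<close> is bounded by the mean of
  \<open>\<bar>f (c + cis \<theta> * w)\<bar>\<close> over \<open>\<theta>\<close>. Integrating over \<open>w\<close> and exchanging the integrals, rotation
  invariance makes the inner integral over \<open>w\<close> independent of \<open>\<theta>\<close>.\<close>

lemma ball_mean_bound:
  assumes cont: "continuous_on (cball c r) f" and holo: "f holomorphic_on ball c r" and r: "r > 0"
  shows "pi * r\<^sup>2 * cmod (f c) \<le> (LINT z:ball c r|lborel. cmod (f z))"
proof -
  define G where "G z = ennreal (indicator (ball c r) z *\<^sub>R cmod (f z))" for z
  define H where "H w = G (c + w)" for w
  have contf: "continuous_on (ball c r) (\<lambda>z. cmod (f z))"
    by (intro continuous_on_norm continuous_on_subset[OF cont]) auto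
  have [measurable]: "G \<in> borel_measurable borel"
    unfolding G_def by (intro measurable_compose[OF _ measurable_ennreal]
      borel_measurable_continuous_on_indicator contf) auto
  have [measurable]: "H \<in> borel_measurable borel" unfolding H_def by measurable
  have [measurable]: "cis \<in> borel_measurable borel"
    by (intro borel_measurable_continuous_onI continuous_intros)
  have integ: "set_integrable lborel (ball c r) (\<lambda>z. cmod (f z))"
  proof (rule set_integrable_subset)
    show "set_integrable lborel (cball c r) (\<lambda>z. cmod (f z))"
      unfolding set_integrable_def by (intro borel_integrable_compact continuous_on_norm cont) auto
  qed auto
  have mass: "(\<integral>\<^sup>+ w. H w \<partial>lborel) = ennreal (LINT z:ball c r|lborel. cmod (f z))"
  proof -
    have "(\<integral>\<^sup>+ w. H w \<partial>lborel) = (\<integral>\<^sup>+ z. G z \<partial>distr lborel borel ((+) c))"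
      unfolding H_def by (subst nn_integral_distr) auto
    also have "\<dots> = (\<integral>\<^sup>+ z. G z \<partial>lborel)" by (simp only: lborel_distr_plus)
    also have "\<dots> = ennreal (LINT z:ball c r|lborel. cmod (f z))"
      unfolding G_def set_lebesgue_integral_def
      using integ by (intro nn_integral_eq_integral) (auto simp: set_integrable_def)
    finally show ?thesis .
  qed
  have rot: "(\<integral>\<^sup>+ w. H (cis \<theta> * w) \<partial>lborel) = (\<integral>\<^sup>+ w. H w \<partial>lborel)" for \<theta>
  proof -
    have "(\<integral>\<^sup>+ w. H w \<partial>lborel) = (\<integral>\<^sup>+ w. H w \<partial>distr lborel borel (\<lambda>w. cis \<theta> * w))"
      by (simp add: lborel_rotate)
    also have "\<dots> = (\<integral>\<^sup>+ w. H (cis \<theta> * w) \<partial>lborel)"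
      by (subst nn_integral_distr) auto
    finally show ?thesis ..
  qed
  have circle: "ennreal (2 * pi * cmod (f c)) * indicator (ball 0 r) w
      \<le> (\<integral>\<^sup>+ \<theta>. H (cis \<theta> * w) * indicator {0..2*pi} \<theta> \<partial>lborel)" for w
  proof (cases "w \<in> ball 0 r")
    case True
    hence w: "cmod w < r" by simp
    define F where "F \<zeta> = f (c + w * \<zeta>)" for \<zeta>
    have in_ball: "c + w * \<zeta> \<in> ball c r" if "cmod \<zeta> \<le> 1" for \<zeta>
      using w that mult_left_le[of "cmod \<zeta>" "cmod w"] by (simp add: dist_norm norm_mult)
    have contF: "continuous_on (cball 0 1) F"
      unfolding F_def by (rule continuous_on_compose2[OF cont])
        (use in_ball in \<open>force intro!: continuous_intros\<close>)+
    have holoF: "F holomorphic_on unit_disk"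
    proof -
      have "(f \<circ> (\<lambda>\<zeta>. c + w * \<zeta>)) holomorphic_on unit_disk"
        using in_ball by (intro holomorphic_on_compose_gen[OF _ holo] holomorphic_intros) force
      moreover have "F = f \<circ> (\<lambda>\<zeta>. c + w * \<zeta>)" by (simp add: F_def fun_eq_iff)
      ultimately show ?thesis by simp
    qed
    have "continuous_on {0..2*pi} (\<lambda>\<theta>. cmod (F (cis \<theta>)))"
      by (intro continuous_on_norm continuous_on_compose2[OF contF]) (auto intro!: continuous_intros)
    hence int: "set_integrable lborel {0..2*pi} (\<lambda>\<theta>. cmod (F (cis \<theta>)))"
      by (rule borel_integrable_atLeastAtMost')
    have "ennreal (2 * pi * cmod (f c)) \<le> ennreal (LINT \<theta>:{0..2 * pi}|lborel. cmod (F (cis \<theta>)))"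
      using circle_mean_bound[OF contF holoF, of 0] by (intro ennreal_leI) (simp add: F_def)
    also have "\<dots> = (\<integral>\<^sup>+ \<theta>. ennreal (indicator {0..2*pi} \<theta> *\<^sub>R cmod (F (cis \<theta>))) \<partial>lborel)"
      unfolding set_lebesgue_integral_def
      using int by (intro nn_integral_eq_integral[symmetric]) (auto simp: set_integrable_def)
    also have "\<dots> = (\<integral>\<^sup>+ \<theta>. H (cis \<theta> * w) * indicator {0..2*pi} \<theta> \<partial>lborel)"
      using in_ball[of "cis _"]
      by (intro nn_integral_cong) (auto simp: H_def G_def F_def mult.commute split: split_indicator)
    finally show ?thesis using True by simp
  qed simp
  have "ennreal (2 * pi * cmod (f c)) * ennreal (pi * r\<^sup>2)
      = (\<integral>\<^sup>+ w. ennreal (2 * pi * cmod (f c)) * indicator (ball 0 r) (w::complex) \<partial>lborel)"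
    using r by (subst nn_integral_cmult_indicator) (auto simp: emeasure_complex_ball)
  also have "\<dots> \<le> (\<integral>\<^sup>+ w. \<integral>\<^sup>+ \<theta>. H (cis \<theta> * w) * indicator {0..2*pi} \<theta> \<partial>lborel \<partial>lborel)"
    by (intro nn_integral_mono circle)
  also have "\<dots> = (\<integral>\<^sup>+ \<theta>. \<integral>\<^sup>+ w. H (cis \<theta> * w) * indicator {0..2*pi} \<theta> \<partial>lborel \<partial>lborel)"
    by (rule lborel_pair.Fubini') measurable
  also have "\<dots> = (\<integral>\<^sup>+ \<theta>. (\<integral>\<^sup>+ w. H w \<partial>lborel) * indicator {0..2*pi} (\<theta>::real) \<partial>lborel)"
    by (intro nn_integral_cong) (simp add: nn_integral_multc rot)
  also have "\<dots> = (\<integral>\<^sup>+ w. H w \<partial>lborel) * ennreal (2 * pi)"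
    by (subst nn_integral_cmult_indicator) auto
  finally have "ennreal (2 * pi * cmod (f c)) * ennreal (pi * r\<^sup>2)
      \<le> ennreal (LINT z:ball c r|lborel. cmod (f z)) * ennreal (2 * pi)"
    unfolding mass .
  moreover have "0 \<le> (LINT z:ball c r|lborel. cmod (f z))"
    unfolding set_lebesgue_integral_def by (intro integral_nonneg_AE) auto
  ultimately have "2 * pi * cmod (f c) * (pi * r\<^sup>2) \<le> (LINT z:ball c r|lborel. cmod (f z)) * (2 * pi)"
    by (simp add: ennreal_mult[symmetric])
  thus ?thesis by (simp add: mult_ac)
qed

text \<open>For \<open>0 \<le> x \<le> 1\<close>, the set where \<open>1 - \<bar>z\<bar>\<^sup>2 > x\<close> is a disc of area \<open>\<pi> (1 - x)\<close>. So the image of area measure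
  under \<open>1 - \<bar>z\<bar>\<^sup>2\<close> is \<open>\<pi>\<close> times Lebesgue measure on the unit interval, which reduces the
  integrability of the Bergman weight to that of \<open>x powr \<alpha>\<close> near \<open>0\<close>.\<close>

lemma distr_disk_defect:
  "distr (restrict_space lborel unit_disk) borel (\<lambda>z. 1 - (cmod z)\<^sup>2) =
   density lborel (\<lambda>x. ennreal (pi * indicator {0..1} x))" (is "?M = ?N")
proof (rule measure_eqI_lessThan)
  have meas[measurable]: "(\<lambda>z. 1 - (cmod z)\<^sup>2) \<in> borel_measurable (restrict_space lborel unit_disk)"
    by (intro measurable_restrict_space1) simp
  have eqM: "emeasure ?M {x<..} = ennreal (pi * (1 - min 1 (max 0 x)))" for x
  proof -
    define y where "y = 1 - min 1 (max 0 x)"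
    have y: "0 \<le> y" "y \<le> 1" by (auto simp: y_def)
    have "(\<lambda>z. 1 - (cmod z)\<^sup>2) -` {x<..} \<inter> unit_disk = ball 0 (sqrt y)"
    proof (intro set_eqI iffI)
      fix z :: complex assume "z \<in> (\<lambda>z. 1 - (cmod z)\<^sup>2) -` {x<..} \<inter> unit_disk"
      hence "(cmod z)\<^sup>2 < 1 - x" "(cmod z)\<^sup>2 < 1" by (auto simp: abs_square_less_1)
      hence "(cmod z)\<^sup>2 < y" using zero_le_power2[of "cmod z"] unfolding y_def by linarith
      thus "z \<in> ball 0 (sqrt y)" by (simp add: real_less_rsqrt)
    next
      fix z :: complex assume "z \<in> ball 0 (sqrt y)"
      hence "cmod z < sqrt y" by simp
      hence zy: "(cmod z)\<^sup>2 < y" using y by (metis norm_ge_zero real_sqrt_less_iff real_sqrt_abs abs_of_nonneg)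
      hence "(cmod z)\<^sup>2 < 1" using y by linarith
      hence "cmod z < 1" by (simp add: abs_square_less_1)
      moreover have "y > 0" using zy by (smt (verit) zero_le_power2)
      hence "y \<le> 1 - x" unfolding y_def by linarith
      ultimately show "z \<in> (\<lambda>z. 1 - (cmod z)\<^sup>2) -` {x<..} \<inter> unit_disk" using zy by auto
    qed
    hence "emeasure ?M {x<..} = emeasure lborel (ball (0::complex) (sqrt y))"
      using y by (subst emeasure_distr) (auto simp: space_restrict_space emeasure_restrict_space subset_ball)
    also have "\<dots> = ennreal (pi * y)"
      using y by (simp add: emeasure_complex_ball)
    finally show ?thesis by (simp add: y_def)
  qed
  have eqN: "emeasure ?N {x<..} = ennreal (pi * (1 - min 1 (max 0 x)))" for x
  proof -
    have "emeasure ?N {x<..} = (\<integral>\<^sup>+ t. ennreal pi * indicator ({0..1} \<inter> {x<..}) t \<partial>lborel)"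
      by (subst emeasure_density) (auto intro!: nn_integral_cong split: split_indicator)
    also have "\<dots> = ennreal pi * emeasure lborel ({0..1} \<inter> {x<..})"
      by (rule nn_integral_cmult_indicator) auto
    also have "{0..1} \<inter> {x<..} = (if x < 0 then {0..1} else {x<..1})" by auto
    also have "ennreal pi * emeasure lborel (if x < 0 then {0..1} else {x<..1}) = ennreal (pi * (1 - min 1 (max 0 x)))"
      by (auto simp: ennreal_mult' min_def max_def)
    finally show ?thesis .
  qed
  show "emeasure ?M {x<..} < \<infinity>" for x unfolding eqM by simp
  show "emeasure ?M {x<..} = emeasure ?N {x<..}" for x unfolding eqM eqN ..
qed auto

lemma integrable_disk_weight:
  assumes "\<alpha> > -1"
  shows "set_integrable lborel unit_disk (\<lambda>z. (1 - (cmod z)\<^sup>2) powr \<alpha>)"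
proof -
  have meas: "(\<lambda>z. 1 - (cmod z)\<^sup>2) \<in> borel_measurable (restrict_space lborel unit_disk)"
    by (intro measurable_restrict_space1) simp
  have "((\<lambda>x. x powr \<alpha>) has_integral (1 powr (\<alpha>+1) / (\<alpha>+1))) {0..1}"
    using assms by (intro has_integral_powr_from_0) auto
  hence "((\<lambda>x. pi * (x powr \<alpha>)) has_integral (pi * (1 powr (\<alpha>+1) / (\<alpha>+1)))) {0..1}"
    by (rule has_integral_mult_right)
  hence I: "((\<lambda>x. pi * indicator {0..1} x * x powr \<alpha>) has_integral (pi * (1 powr (\<alpha>+1) / (\<alpha>+1)))) UNIV"
    by (subst (asm) has_integral_restrict_UNIV[symmetric]) (auto elim!: has_integral_eq[rotated] split: split_indicator)

  have "(\<integral>\<^sup>+ z. ennreal ((1 - (cmod z)\<^sup>2) powr \<alpha>) * indicator unit_disk z \<partial>lborel)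
     = (\<integral>\<^sup>+ z. ennreal ((1 - (cmod z)\<^sup>2) powr \<alpha>) \<partial>restrict_space lborel unit_disk)"
    by (subst nn_integral_restrict_space) auto
  also have "\<dots> = (\<integral>\<^sup>+ x. ennreal (x powr \<alpha>) \<partial>distr (restrict_space lborel unit_disk) borel (\<lambda>z. 1 - (cmod z)\<^sup>2))"
    using meas by (subst nn_integral_distr) auto
  also have "\<dots> = (\<integral>\<^sup>+ x. ennreal (pi * indicator {0..1} x) * ennreal (x powr \<alpha>) \<partial>lborel)"
    unfolding distr_disk_defect by (rule nn_integral_density) auto
  also have "\<dots> = (\<integral>\<^sup>+ x. ennreal (pi * indicator {0..1} x * x powr \<alpha>) \<partial>lborel)"
    by (simp add: ennreal_mult')
  also have "\<dots> = ennreal (pi * (1 powr (\<alpha>+1) / (\<alpha>+1)))"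
    by (rule nn_integral_has_integral_lborel[OF _ _ I]) auto
  finally have fin: "(\<integral>\<^sup>+ z. ennreal ((1 - (cmod z)\<^sup>2) powr \<alpha>) * indicator unit_disk z \<partial>lborel) < \<infinity>"
    by simp
  show ?thesis unfolding set_integrable_def
  proof (rule integrableI_bounded)
    show "(\<integral>\<^sup>+ z. ennreal (norm (indicat_real unit_disk z *\<^sub>R (1 - (cmod z)\<^sup>2) powr \<alpha>)) \<partial>lborel) < \<infinity>"
      using fin by (auto simp: mult.commute ennreal_mult' ennreal_indicator abs_mult)
  qed (intro borel_measurable_scaleR borel_measurable_indicator powr_real_measurable; simp)
qed

section \<open>Bergman and Hardy spaces as function spaces on the disc\<close>

text \<open>The elements are total functions of which only the restriction to the disc matters, hence the two
  congruence axioms. The growth axiom is stated on the unit ball only; homogeneity of the norm extends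
  it to a pointwise bound by a multiple of the norm.\<close>

locale disk_function_space =
  fixes X :: "(complex \<Rightarrow> complex) set" and N :: "(complex \<Rightarrow> complex) \<Rightarrow> real"
  assumes holo: "f \<in> X \<Longrightarrow> f holomorphic_on unit_disk"
    and cong: "f \<in> X \<Longrightarrow> (\<And>z. z \<in> unit_disk \<Longrightarrow> g z = f z) \<Longrightarrow> g \<in> X"
    and norm_cong: "(\<And>z. z \<in> unit_disk \<Longrightarrow> g z = f z) \<Longrightarrow> N g = N f"
    and diff: "f \<in> X \<Longrightarrow> g \<in> X \<Longrightarrow> (\<lambda>z. f z - g z) \<in> X"
    and scale: "f \<in> X \<Longrightarrow> (\<lambda>z. c * f z) \<in> X"
    and norm_scale: "f \<in> X \<Longrightarrow> N (\<lambda>z. c * f z) \<le> cmod c * N f"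
    and norm_nonneg: "0 \<le> N f"
    and bounded_mem: "f holomorphic_on unit_disk \<Longrightarrow> (\<And>z. z \<in> unit_disk \<Longrightarrow> cmod (f z) \<le> B) \<Longrightarrow> f \<in> X"
    and unit_ball_growth: "\<exists>C K. \<forall>f\<in>X. N f \<le> 1 \<longrightarrow>
          (\<forall>z\<in>unit_disk. cmod (f z) \<le> C * (1 - (cmod z)\<^sup>2) powr (- K))"

lemma powr_norm_diff_le:
  fixes a b :: complex assumes "p \<ge> 0"
  shows "cmod (a - b) powr p \<le> 2 powr p * (cmod a powr p + cmod b powr p)"
proof -
  have "cmod (a - b) \<le> 2 * max (cmod a) (cmod b)"
    using norm_triangle_ineq4[of a b] by linarith
  hence "cmod (a - b) powr p \<le> (2 * max (cmod a) (cmod b)) powr p"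
    using assms by (intro powr_mono2) auto
  also have "\<dots> = 2 powr p * max (cmod a) (cmod b) powr p"
    by (simp add: powr_mult)
  also have "\<dots> \<le> 2 powr p * (cmod a powr p + cmod b powr p)"
    by (intro mult_left_mono) (auto simp: max_def)
  finally show ?thesis .
qed

text \<open>This crude bound replaces Hoelder's inequality: it compares the integral of \<open>\<bar>f\<bar>\<close> with that of
  \<open>\<bar>f\<bar>\<^sup>p\<close>, which suffices for functions in the unit ball.\<close>

lemma le_one_plus_powr: "(p::real) \<ge> 1 \<Longrightarrow> x \<ge> 0 \<Longrightarrow> x \<le> 1 + x powr p"
proof (cases "x \<le> 1")
  case False
  assume "p \<ge> 1"
  hence "x powr 1 \<le> x powr p" using False by (intro powr_mono) auto
  thus ?thesis using False by simp
qed (auto intro: add_increasing2)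

lemma powr_inverse_le_oneD: "(p::real) > 0 \<Longrightarrow> x \<ge> 0 \<Longrightarrow> x powr (1 / p) \<le> 1 \<Longrightarrow> x \<le> 1"
  by (metis gr_one_powr less_eq_real_def linorder_not_le zero_less_divide_1_iff)

lemma disk_defect_bounds:
  assumes "z \<in> unit_disk"
  shows "0 < 1 - (cmod z)\<^sup>2" "1 - (cmod z)\<^sup>2 \<le> 1" "1 - (cmod z)\<^sup>2 \<le> 2 * (1 - cmod z)" "1 - cmod z \<le> 1 - (cmod z)\<^sup>2"
proof -
  have z: "0 \<le> cmod z" "cmod z < 1" using assms by auto
  show "0 < 1 - (cmod z)\<^sup>2" using z by (simp add: abs_square_less_1)
  show "1 - (cmod z)\<^sup>2 \<le> 1" by simp
  have "0 \<le> (1 - cmod z)\<^sup>2" by simp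
  thus "1 - (cmod z)\<^sup>2 \<le> 2 * (1 - cmod z)" unfolding power2_diff by simp
  show "1 - cmod z \<le> 1 - (cmod z)\<^sup>2" using z by (simp add: power2_eq_square mult_left_le)
qed

text \<open>Growth: on the disc about \<open>z\<close> with radius \<open>r = (1 - \<bar>z\<bar>) / 2\<close> the defect \<open>1 - \<bar>w\<bar>\<^sup>2\<close> lies between
  \<open>r\<close> and \<open>1\<close>, so the weight is at least \<open>r powr \<bar>\<alpha>\<bar>\<close> whatever the sign of \<open>\<alpha>\<close>, and the area
  mean value bound gives the exponent \<open>\<bar>\<alpha>\<bar> + 2\<close>.\<close>

lemma bergman_disk_function_space:
  assumes p: "p \<ge> 1" and \<alpha>: "\<alpha> > -1"
  shows "disk_function_space (bergman_space p \<alpha>) (bergman_norm p \<alpha>)"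
proof
  define W where "W f = (\<lambda>z. cmod (f z) powr p * (1 - (cmod z)\<^sup>2) powr \<alpha>)" for f :: "complex \<Rightarrow> complex"
  have W_nonneg: "0 \<le> W f z" for f z by (simp add: W_def)
  have mem: "f \<in> bergman_space p \<alpha> \<longleftrightarrow> f holomorphic_on unit_disk \<and> set_integrable lborel unit_disk (W f)" for f
    by (simp add: bergman_space_def W_def)
  have nrm: "bergman_norm p \<alpha> f = (1 / pi * (LINT z:unit_disk|lborel. W f z)) powr (1 / p)" for f
    by (simp add: bergman_norm_def W_def)
  have int_nonneg: "0 \<le> (LINT z:A|lborel. W f z)" for f A
    unfolding set_lebesgue_integral_def by (intro integral_nonneg_AE) (auto simp: W_nonneg)
  have meas: "set_borel_measurable lborel unit_disk (W f)" if "f holomorphic_on unit_disk" for f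
  proof -
    have "1 - (cmod z)\<^sup>2 \<noteq> 0" if "z \<in> unit_disk" for z
      using disk_defect_bounds(1)[OF that] by simp
    hence "continuous_on unit_disk (W f)"
      unfolding W_def using p that
      by (intro continuous_intros continuous_on_powr' holomorphic_on_imp_continuous_on) auto
    thus ?thesis unfolding set_borel_measurable_def
      using borel_measurable_continuous_on_indicator[of unit_disk "W f"] by simp
  qed
  have dominated: "set_integrable lborel unit_disk (W f)"
    if "f holomorphic_on unit_disk" "set_integrable lborel unit_disk g"
      "\<And>z. z \<in> unit_disk \<Longrightarrow> W f z \<le> g z" for f g
  proof (rule set_integrable_bound[OF that(2)])
    show "AE z in lborel. z \<in> unit_disk \<longrightarrow> norm (W f z) \<le> norm (g z)"
      using that(3) by (intro AE_I2 impI) (smt (verit) W_nonneg real_norm_def)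
  qed (rule meas, fact)
  show "f holomorphic_on unit_disk" if "f \<in> bergman_space p \<alpha>" for f
    using that by (simp add: mem)
  have Wcong: "set_integrable lborel unit_disk (W g) = set_integrable lborel unit_disk (W f)"
    if "\<And>z. z \<in> unit_disk \<Longrightarrow> g z = f z" for f g
    using that by (intro set_integrable_cong) (auto simp: W_def)
  show "g \<in> bergman_space p \<alpha>" if "f \<in> bergman_space p \<alpha>" "\<And>z. z \<in> unit_disk \<Longrightarrow> g z = f z" for f g
    using that Wcong[of g f] holomorphic_cong[of unit_disk unit_disk g f] by (simp add: mem)
  show "bergman_norm p \<alpha> g = bergman_norm p \<alpha> f" if "\<And>z. z \<in> unit_disk \<Longrightarrow> g z = f z" for f g
  proof -
    have "(LINT z:unit_disk|lborel. W g z) = (LINT z:unit_disk|lborel. W f z)"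
      using that by (intro set_lebesgue_integral_cong) (auto simp: W_def)
    thus ?thesis by (simp add: nrm)
  qed
  show "(\<lambda>z. f z - g z) \<in> bergman_space p \<alpha>" if "f \<in> bergman_space p \<alpha>" "g \<in> bergman_space p \<alpha>" for f g
  proof -
    have hol: "(\<lambda>z. f z - g z) holomorphic_on unit_disk"
      using that by (auto simp: mem intro: holomorphic_intros)
    have "set_integrable lborel unit_disk (\<lambda>z. 2 powr p * (W f z + W g z))"
      using that by (intro set_integrable_mult_right set_integral_add) (auto simp: mem)
    moreover have "W (\<lambda>z. f z - g z) z \<le> 2 powr p * (W f z + W g z)" for z
      using mult_right_mono[OF powr_norm_diff_le[of p "f z" "g z"], of "(1 - (cmod z)\<^sup>2) powr \<alpha>"] p
      by (simp add: W_def algebra_simps)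
    ultimately show ?thesis using hol dominated[OF hol] by (auto simp: mem)
  qed
  have Wscale: "W (\<lambda>z. c * f z) = (\<lambda>z. cmod c powr p * W f z)" for c f
    by (simp add: W_def norm_mult powr_mult mult.assoc fun_eq_iff)
  show "(\<lambda>z. c * f z) \<in> bergman_space p \<alpha>" if "f \<in> bergman_space p \<alpha>" for f c
    using that by (auto simp: mem Wscale intro!: holomorphic_intros set_integrable_mult_right)
  show "bergman_norm p \<alpha> (\<lambda>z. c * f z) \<le> cmod c * bergman_norm p \<alpha> f" for f c
  proof -
    have "bergman_norm p \<alpha> (\<lambda>z. c * f z) = (cmod c powr p * (1 / pi * (LINT z:unit_disk|lborel. W f z))) powr (1 / p)"
      by (simp add: nrm Wscale)
    also have "\<dots> = cmod c * bergman_norm p \<alpha> f"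
      unfolding nrm using p int_nonneg[of unit_disk f] by (subst powr_mult) (auto simp: powr_powr)
    finally show ?thesis by simp
  qed
  show "0 \<le> bergman_norm p \<alpha> f" for f by (simp add: nrm)
  show "f \<in> bergman_space p \<alpha>" if hol: "f holomorphic_on unit_disk"
    and B: "\<And>z. z \<in> unit_disk \<Longrightarrow> cmod (f z) \<le> B" for f B
  proof -
    have "set_integrable lborel unit_disk (\<lambda>z. B powr p * (1 - (cmod z)\<^sup>2) powr \<alpha>)"
      by (intro set_integrable_mult_right integrable_disk_weight \<alpha>)
    moreover have "W f z \<le> B powr p * (1 - (cmod z)\<^sup>2) powr \<alpha>" if "z \<in> unit_disk" for z
      unfolding W_def using B[OF that] p by (intro mult_right_mono powr_mono2) auto
    ultimately show ?thesis using hol dominated[OF hol] by (auto simp: mem)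
  qed
  have quarter: "(x / 4) powr (- k) = 4 powr k * x powr (- k)" if "x > 0" for x k :: real
    using that by (simp add: powr_divide powr_minus field_simps)
  have "cmod (f z) \<le> (2 * 4 powr (\<bar>\<alpha>\<bar> + 2)) * (1 - (cmod z)\<^sup>2) powr (- (\<bar>\<alpha>\<bar> + 2))"
    if f: "f \<in> bergman_space p \<alpha>" and N: "bergman_norm p \<alpha> f \<le> 1" and z: "z \<in> unit_disk" for f z
  proof -
    define r where "r = (1 - cmod z) / 2"
    define d where "d = r powr (- \<bar>\<alpha>\<bar>)"
    have r: "0 < r" "r \<le> 1" using z norm_ge_zero[of z] by (simp_all add: r_def del: norm_ge_zero)
    have sub: "cball z r \<subseteq> unit_disk"
    proof
      fix w assume "w \<in> cball z r"
      hence "cmod w \<le> cmod z + r" using norm_triangle_sub[of w z] by (simp add: dist_norm norm_minus_commute)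
      thus "w \<in> unit_disk" using z by (simp add: r_def field_simps)
    qed
    have hol: "f holomorphic_on unit_disk" and int: "set_integrable lborel unit_disk (W f)"
      using f by (auto simp: mem)
    have "1 / pi * (LINT z:unit_disk|lborel. W f z) \<le> 1"
      by (rule powr_inverse_le_oneD[of p]) (use N p int_nonneg[of unit_disk f] in \<open>auto simp: nrm\<close>)
    hence I: "(LINT z:unit_disk|lborel. W f z) \<le> pi" by (simp add: field_simps)
    have intb: "set_integrable lborel (ball z r) (W f)"
      by (rule set_integrable_subset[OF int]) (use sub ball_subset_cball in auto)
    have Ib: "(LINT z:ball z r|lborel. W f z) \<le> pi"
    proof -
      have "(LINT z:ball z r|lborel. W f z) \<le> (LINT z:unit_disk|lborel. W f z)"
        unfolding set_lebesgue_integral_def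
      proof (rule integral_mono)
        show "indicator (ball z r) w *\<^sub>R W f w \<le> indicator unit_disk w *\<^sub>R W f w" for w
          by (intro scaleR_right_mono indicator_leI W_nonneg) (use sub ball_subset_cball in blast)
      qed (use int intb in \<open>simp_all add: set_integrable_def\<close>)
      thus ?thesis using I by simp
    qed
    have pointwise: "cmod (f w) \<le> 1 + d * W f w" if "w \<in> ball z r" for w
    proof -
      define x where "x = 1 - (cmod w)\<^sup>2"
      have wd: "w \<in> unit_disk" using that sub ball_subset_cball by blast
      have "r \<le> 1 - cmod w"
        using that norm_triangle_sub[of w z] by (simp add: r_def dist_norm norm_minus_commute field_simps)
      hence x: "r \<le> x" "x \<le> 1" using disk_defect_bounds[OF wd] by (auto simp: x_def)
      have "r powr \<bar>\<alpha>\<bar> \<le> x powr \<bar>\<alpha>\<bar>" using x r by (intro powr_mono2) auto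
      also have "\<dots> \<le> x powr \<alpha>" using x r by (intro powr_mono') auto
      finally have "1 \<le> d * x powr \<alpha>"
        using r by (simp add: d_def powr_minus field_simps)
      hence "cmod (f w) powr p * 1 \<le> cmod (f w) powr p * (d * x powr \<alpha>)"
        by (intro mult_left_mono) auto
      hence "cmod (f w) powr p \<le> d * W f w" by (simp add: W_def x_def mult_ac)
      thus ?thesis using le_one_plus_powr[OF p, of "cmod (f w)"] by simp
    qed
    have int1: "set_integrable lborel (ball z r) (\<lambda>w. 1::real)"
      unfolding set_integrable_def by (simp add: emeasure_complex_ball r less_imp_le)
    have int2: "set_integrable lborel (ball z r) (\<lambda>w. 1 + d * W f w)"
      by (intro set_integral_add int1 set_integrable_mult_right intb)
    have cont: "continuous_on (cball z r) f" and holb: "f holomorphic_on ball z r"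
      by (rule continuous_on_subset[OF holomorphic_on_imp_continuous_on[OF hol] sub],
          rule holomorphic_on_subset[OF hol order_trans[OF ball_subset_cball sub]])
    have int3: "set_integrable lborel (ball z r) (\<lambda>w. cmod (f w))"
    proof (rule set_integrable_subset)
      show "set_integrable lborel (cball z r) (\<lambda>z. cmod (f z))"
        unfolding set_integrable_def by (intro borel_integrable_compact continuous_on_norm cont) auto
    qed auto
    have "pi * r\<^sup>2 * cmod (f z) \<le> (LINT w:ball z r|lborel. cmod (f w))"
      by (rule ball_mean_bound[OF cont holb r(1)])
    also have "\<dots> \<le> (LINT w:ball z r|lborel. 1 + d * W f w)"
      by (rule set_integral_mono[OF int3 int2]) (use pointwise in auto)
    also have "\<dots> = pi * r\<^sup>2 + d * (LINT w:ball z r|lborel. W f w)"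
    proof -
      have "(LINT w:ball z r|lborel. (1::real)) = pi * r\<^sup>2"
        using r by (simp add: set_lebesgue_integral_def measure_def emeasure_complex_ball)
      thus ?thesis
        by (subst set_integral_add(2)) (auto intro!: int1 set_integrable_mult_right intb)
    qed
    also have "\<dots> \<le> pi * r\<^sup>2 + d * pi" using Ib by (intro add_left_mono mult_left_mono) (auto simp: d_def)
    finally have "pi * (r\<^sup>2 * cmod (f z)) \<le> pi * (r\<^sup>2 + d)" by (simp add: algebra_simps)
    hence "r\<^sup>2 * cmod (f z) \<le> r\<^sup>2 + d" by simp
    also have "\<dots> \<le> 2 * d"
    proof -
      have "r\<^sup>2 \<le> 1" using r by (simp add: power_le_one)
      moreover have "1 \<le> d" unfolding d_def using r by (simp add: powr_minus field_simps powr_le1)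
      ultimately show ?thesis by simp
    qed
    finally have "cmod (f z) \<le> 2 * (d / r\<^sup>2)" using r by (simp add: field_simps)
    also have "d / r\<^sup>2 = r powr (- (\<bar>\<alpha>\<bar> + 2))"
      using r by (simp add: d_def powr_diff powr_minus powr_add divide_simps flip: powr_numeral)
    also have "\<dots> \<le> ((1 - (cmod z)\<^sup>2) / 4) powr (- (\<bar>\<alpha>\<bar> + 2))"
      using disk_defect_bounds[OF z] by (intro powr_mono2') (auto simp: r_def)
    also have "\<dots> = 4 powr (\<bar>\<alpha>\<bar> + 2) * (1 - (cmod z)\<^sup>2) powr (- (\<bar>\<alpha>\<bar> + 2))"
      using quarter[OF disk_defect_bounds(1)[OF z]] .
    finally show ?thesis by simp
  qed
  thus "\<exists>C K. \<forall>f\<in>bergman_space p \<alpha>. bergman_norm p \<alpha> f \<le> 1 \<longrightarrow>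
          (\<forall>z\<in>unit_disk. cmod (f z) \<le> C * (1 - (cmod z)\<^sup>2) powr (- K))"
    by blast
qed


text \<open>Growth: the circle mean bound on the circle of radius \<open>(1 + \<bar>z\<bar>) / 2\<close>, whose distance from \<open>z\<close> is
  \<open>(1 - \<bar>z\<bar>) / 2\<close>.\<close>

lemma hardy_disk_function_space:
  assumes p: "p \<ge> 1"
  shows "disk_function_space (hardy_space p) (hardy_norm p)"
proof
  have cont: "continuous_on {0..2 * pi} (\<lambda>\<theta>. cmod (f (of_real r * cis \<theta>)) powr p)"
    if f: "f holomorphic_on unit_disk" and r: "r \<in> {0..<1}" for f r
  proof -
    have "continuous_on {0..2 * pi} (\<lambda>\<theta>. f (of_real r * cis \<theta>))"
      by (rule continuous_on_compose2[OF holomorphic_on_imp_continuous_on[OF f]])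
        (use r in \<open>auto intro!: continuous_intros simp: norm_mult\<close>)
    thus ?thesis using p by (intro continuous_on_powr' continuous_intros) auto
  qed
  have integ: "set_integrable lborel {0..2 * pi} (\<lambda>\<theta>. cmod (f (of_real r * cis \<theta>)) powr p)"
    if "f holomorphic_on unit_disk" "r \<in> {0..<1}" for f r
    by (rule borel_integrable_atLeastAtMost') (rule cont[OF that])
  have mean_nonneg: "0 \<le> hardy_mean p f r" for f r
    unfolding hardy_mean_def set_lebesgue_integral_def by (intro integral_nonneg_AE) auto
  have mean_cong: "hardy_mean p g r = hardy_mean p f r"
    if "\<And>z. z \<in> unit_disk \<Longrightarrow> g z = f z" "r \<in> {0..<1}" for f g r
    unfolding hardy_mean_def using that
    by (intro set_lebesgue_integral_cong) (auto simp: norm_mult)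
  show "f holomorphic_on unit_disk" if "f \<in> hardy_space p" for f
    using that by (simp add: hardy_space_def)
  show "g \<in> hardy_space p" if "f \<in> hardy_space p" "\<And>z. z \<in> unit_disk \<Longrightarrow> g z = f z" for f g
  proof -
    have "hardy_mean p g ` {0..<1} = hardy_mean p f ` {0..<1}"
      using mean_cong[of g f] that(2) by (intro image_cong) auto
    thus ?thesis using that holomorphic_cong[of unit_disk unit_disk g f] by (simp add: hardy_space_def)
  qed
  show "hardy_norm p g = hardy_norm p f" if "\<And>z. z \<in> unit_disk \<Longrightarrow> g z = f z" for f g
  proof -
    have "(SUP r\<in>{0..<1}. hardy_mean p g r) = (SUP r\<in>{0..<1}. hardy_mean p f r)"
      using mean_cong[of g f] that by (intro SUP_cong) auto
    thus ?thesis by (simp add: hardy_norm_def)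
  qed
  show "(\<lambda>z. f z - g z) \<in> hardy_space p" if fg: "f \<in> hardy_space p" "g \<in> hardy_space p" for f g
  proof -
    from fg obtain A B where A: "\<And>r. r \<in> {0..<1} \<Longrightarrow> hardy_mean p f r \<le> A"
      and B: "\<And>r. r \<in> {0..<1} \<Longrightarrow> hardy_mean p g r \<le> B"
      unfolding hardy_space_def bdd_above_def by blast
    have hol: "f holomorphic_on unit_disk" "g holomorphic_on unit_disk"
      using fg by (auto simp: hardy_space_def)
    have hold: "(\<lambda>z. f z - g z) holomorphic_on unit_disk" using hol by (intro holomorphic_intros)
    have "hardy_mean p (\<lambda>z. f z - g z) r \<le> 2 powr p * (A + B)" if r: "r \<in> {0..<1}" for r
    proof -
      have "hardy_mean p (\<lambda>z. f z - g z) r \<le> (LINT \<theta>:{0..2 * pi}|lborel. 2 powr p *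
          (cmod (f (of_real r * cis \<theta>)) powr p + cmod (g (of_real r * cis \<theta>)) powr p))"
        unfolding hardy_mean_def using p
        by (intro set_integral_mono integ[OF hold r] set_integrable_mult_right set_integral_add integ hol r
            powr_norm_diff_le) auto
      also have "\<dots> = 2 powr p * (hardy_mean p f r + hardy_mean p g r)"
        unfolding hardy_mean_def using integ[OF hol(1) r] integ[OF hol(2) r] by (simp add: set_integral_add)
      also have "\<dots> \<le> 2 powr p * (A + B)" using A[OF r] B[OF r] by (intro mult_left_mono) auto
      finally show ?thesis .
    qed
    thus ?thesis using hold by (auto simp: hardy_space_def intro: bdd_aboveI2[where M = "2 powr p * (A + B)"])
  qed
  have mean_scale: "hardy_mean p (\<lambda>z. c * f z) r = cmod c powr p * hardy_mean p f r" for c f r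
    by (simp add: hardy_mean_def norm_mult powr_mult)
  show scale_mem: "(\<lambda>z. c * f z) \<in> hardy_space p" if f: "f \<in> hardy_space p" for f c
  proof -
    from f obtain A where A: "\<And>r. r \<in> {0..<1} \<Longrightarrow> hardy_mean p f r \<le> A"
      unfolding hardy_space_def bdd_above_def by blast
    have "hardy_mean p (\<lambda>z. c * f z) r \<le> cmod c powr p * A" if "r \<in> {0..<1}" for r
      unfolding mean_scale using A[OF that] by (intro mult_left_mono) auto
    thus ?thesis using f
      by (auto simp: hardy_space_def intro!: holomorphic_intros bdd_aboveI2[where M = "cmod c powr p * A"])
  qed
  have sup_nonneg: "0 \<le> (SUP r\<in>{0..<1}. hardy_mean p f r)" if "f \<in> hardy_space p" for f
    using that mean_nonneg[of f 0] by (intro cSUP_upper2[where x = 0]) (auto simp: hardy_space_def)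
  show "hardy_norm p (\<lambda>z. c * f z) \<le> cmod c * hardy_norm p f" if f: "f \<in> hardy_space p" for f c
  proof -
    let ?S = "SUP r\<in>{0..<1}. hardy_mean p f r"
    have le: "(SUP r\<in>{0..<1}. hardy_mean p (\<lambda>z. c * f z) r) \<le> cmod c powr p * ?S"
      unfolding mean_scale using f
      by (intro cSUP_least mult_left_mono cSUP_upper) (auto simp: hardy_space_def)
    moreover have "0 \<le> (SUP r\<in>{0..<1}. hardy_mean p (\<lambda>z. c * f z) r)"
      by (rule sup_nonneg[OF scale_mem[OF f]])
    ultimately have "hardy_norm p (\<lambda>z. c * f z) \<le> (cmod c powr p * ?S) powr (1 / p)"
      unfolding hardy_norm_def using p by (intro powr_mono2) auto
    also have "\<dots> = cmod c * hardy_norm p f"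
      unfolding hardy_norm_def using p sup_nonneg[OF f] by (subst powr_mult) (auto simp: powr_powr)
    finally show ?thesis .
  qed
  show "0 \<le> hardy_norm p f" for f by (simp add: hardy_norm_def)
  show "f \<in> hardy_space p" if hol: "f holomorphic_on unit_disk"
    and B: "\<And>z. z \<in> unit_disk \<Longrightarrow> cmod (f z) \<le> B" for f B
  proof -
    have "hardy_mean p f r \<le> 2 * pi * B powr p" if r: "r \<in> {0..<1}" for r
    proof -
      have "hardy_mean p f r \<le> (LINT \<theta>:{0..2 * pi}|lborel. B powr p)"
        unfolding hardy_mean_def
      proof (rule set_integral_mono[OF integ[OF hol r]])
        show "set_integrable lborel {0..2 * pi} (\<lambda>\<theta>. B powr p)"
          by (rule borel_integrable_atLeastAtMost') simp
        show "cmod (f (of_real r * cis \<theta>)) powr p \<le> B powr p" for \<theta>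
          using r p by (intro powr_mono2 B) (auto simp: norm_mult)
      qed
      also have "\<dots> = 2 * pi * B powr p" by (simp add: set_lebesgue_integral_def)
      finally show ?thesis .
    qed
    thus ?thesis using hol by (auto simp: hardy_space_def intro: bdd_aboveI2[where M = "2 * pi * B powr p"])
  qed
  have "cmod (f z) \<le> 8 * (1 - (cmod z)\<^sup>2) powr (- 1)"
    if f: "f \<in> hardy_space p" and N: "hardy_norm p f \<le> 1" and z: "z \<in> unit_disk" for f z
  proof -
    define r where "r = (1 + cmod z) / 2"
    have r: "r \<in> {0..<1}" "0 < r" "cmod z < r" using z by (auto simp: r_def add_pos_nonneg)
    have hol: "f holomorphic_on unit_disk" using f by (simp add: hardy_space_def)
    have "(SUP r\<in>{0..<1}. hardy_mean p f r) \<le> 1"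
      by (rule powr_inverse_le_oneD[of p]) (use N p sup_nonneg[OF f] in \<open>auto simp: hardy_norm_def\<close>)
    moreover have "hardy_mean p f r \<le> (SUP r\<in>{0..<1}. hardy_mean p f r)"
      using f r by (intro cSUP_upper) (auto simp: hardy_space_def)
    ultimately have m: "hardy_mean p f r \<le> 1" by simp
    define F where "F \<zeta> = f (of_real r * \<zeta>)" for \<zeta>
    have in_disk: "of_real r * \<zeta> \<in> unit_disk" if "cmod \<zeta> \<le> 1" for \<zeta>
    proof -
      have "r * cmod \<zeta> \<le> r" using r that by (intro mult_left_le) auto
      also have "r < 1" using r by simp
      finally show ?thesis using r by (simp add: norm_mult)
    qed
    have contF: "continuous_on (cball 0 1) F"
      unfolding F_def by (rule continuous_on_compose2[OF holomorphic_on_imp_continuous_on[OF hol]])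
        (use in_disk in \<open>force intro!: continuous_intros\<close>)+
    have holoF: "F holomorphic_on unit_disk"
    proof -
      have "(f \<circ> (\<lambda>\<zeta>. of_real r * \<zeta>)) holomorphic_on unit_disk"
        using in_disk by (intro holomorphic_on_compose_gen[OF _ hol] holomorphic_intros) force
      moreover have "F = f \<circ> (\<lambda>\<zeta>. of_real r * \<zeta>)" by (simp add: F_def fun_eq_iff)
      ultimately show ?thesis by simp
    qed
    have "continuous_on {0..2*pi} (\<lambda>\<theta>. cmod (F (cis \<theta>)))"
      by (intro continuous_on_norm continuous_on_compose2[OF contF]) (auto intro!: continuous_intros)
    hence int: "set_integrable lborel {0..2*pi} (\<lambda>\<theta>. cmod (F (cis \<theta>)))"
      by (rule borel_integrable_atLeastAtMost')
    have int1: "set_integrable lborel {0..2*pi} (\<lambda>\<theta>. 1::real)"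
      by (rule borel_integrable_atLeastAtMost') simp
    have "2 * pi * (1 - cmod (z / of_real r)) * cmod (F (z / of_real r)) \<le> (LINT \<theta>:{0..2 * pi}|lborel. cmod (F (cis \<theta>)))"
      by (rule circle_mean_bound[OF contF holoF]) (use r in \<open>simp add: norm_divide\<close>)
    also have "\<dots> \<le> (LINT \<theta>:{0..2 * pi}|lborel. 1 + cmod (f (of_real r * cis \<theta>)) powr p)"
      by (rule set_integral_mono[OF int set_integral_add(1)[OF int1 integ[OF hol r(1)]]])
        (use le_one_plus_powr[OF p] in \<open>auto simp: F_def\<close>)
    also have "\<dots> = 2 * pi + hardy_mean p f r"
      unfolding hardy_mean_def
      by (subst set_integral_add(2)[OF int1 integ[OF hol r(1)]]) (simp add: set_lebesgue_integral_def)
    also have "\<dots> \<le> 2 * pi + 2 * pi" using m pi_gt3 by simp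
    finally have "2 * pi * ((1 - cmod z / r) * cmod (f z)) \<le> 2 * pi * 2"
      using r by (simp add: F_def norm_divide mult_ac)
    hence *: "(1 - cmod z / r) * cmod (f z) \<le> 2" by (subst (asm) mult_le_cancel_left_pos) auto
    have "(1 - (cmod z)\<^sup>2) / 4 \<le> r - cmod z"
      using disk_defect_bounds(3)[OF z] by (simp add: r_def field_simps)
    also have "\<dots> \<le> (r - cmod z) / r"
      using r mult_left_le[of r "r - cmod z"] by (subst pos_le_divide_eq) auto
    also have "\<dots> = 1 - cmod z / r" using r by (simp add: field_simps)
    finally have "(1 - (cmod z)\<^sup>2) / 4 * cmod (f z) \<le> (1 - cmod z / r) * cmod (f z)"
      by (intro mult_right_mono) auto
    hence "(1 - (cmod z)\<^sup>2) / 4 * cmod (f z) \<le> 2" using * by linarith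
    thus ?thesis using disk_defect_bounds(1)[OF z] by (simp add: powr_minus field_simps)
  qed
  thus "\<exists>C K. \<forall>f\<in>hardy_space p. hardy_norm p f \<le> 1 \<longrightarrow>
          (\<forall>z\<in>unit_disk. cmod (f z) \<le> C * (1 - (cmod z)\<^sup>2) powr (- K))"
    by blast
qed

context disk_function_space begin

text \<open>Multiplying \<open>f\<close> by \<open>1 / (N f + e)\<close> brings it into the unit ball; then \<open>e\<close> tends to \<open>0\<close>. The
  detour through \<open>e\<close> covers the case \<open>N f = 0\<close>. The exponent can be made nonnegative because the
  base is at most one.\<close>

lemma pointwise_growth:
  obtains C K where "K \<ge> 0"
    "\<And>f z. f \<in> X \<Longrightarrow> z \<in> unit_disk \<Longrightarrow> cmod (f z) \<le> N f * (C * (1 - (cmod z)\<^sup>2) powr (- K))"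
proof -
  obtain C K where CK: "\<And>f z. f \<in> X \<Longrightarrow> N f \<le> 1 \<Longrightarrow> z \<in> unit_disk \<Longrightarrow>
      cmod (f z) \<le> C * (1 - (cmod z)\<^sup>2) powr (- K)"
    using unit_ball_growth by blast
  have "cmod (f z) \<le> N f * (\<bar>C\<bar> * (1 - (cmod z)\<^sup>2) powr (- \<bar>K\<bar>))" if f: "f \<in> X" and z: "z \<in> unit_disk" for f z
  proof -
    define b where "b = \<bar>C\<bar> * (1 - (cmod z)\<^sup>2) powr (- \<bar>K\<bar>)"
    have "(1 - (cmod z)\<^sup>2) powr (- K) \<le> (1 - (cmod z)\<^sup>2) powr (- \<bar>K\<bar>)"
      using disk_defect_bounds[OF z] by (intro powr_mono') auto
    hence b: "C * (1 - (cmod z)\<^sup>2) powr (- K) \<le> b"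
      unfolding b_def by (intro mult_mono) auto
    have eps: "cmod (f z) \<le> (N f + e) * b" if "e > 0" for e
    proof -
      define c where "c = 1 / (N f + e)"
      have c: "c > 0" using norm_nonneg[of f] that by (simp add: c_def)
      have "N (\<lambda>z. of_real c * f z) \<le> c * N f"
        using norm_scale[OF f, of "of_real c"] c by simp
      also have "\<dots> \<le> 1" using norm_nonneg[of f] that by (simp add: c_def)
      finally have "cmod (of_real c * f z) \<le> b"
        using CK[OF scale[OF f] _ z] b by fastforce
      hence "c * cmod (f z) \<le> b" using c by (simp add: norm_mult)
      thus ?thesis using norm_nonneg[of f] that by (simp add: c_def field_simps)
    qed
    have "((\<lambda>e. (N f + e) * b) \<longlongrightarrow> (N f + 0) * b) (at_right 0)"
      by (intro tendsto_intros)
    moreover have "\<forall>\<^sub>F e in at_right 0. cmod (f z) \<le> (N f + e) * b"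
      using eps by (auto simp: eventually_at_right_less intro: eventually_mono[OF eventually_at_right_less])
    ultimately have "cmod (f z) \<le> (N f + 0) * b"
      by (rule tendsto_lowerbound) simp
    thus ?thesis by (simp add: b_def)
  qed
  thus ?thesis by (intro that[of "\<bar>K\<bar>" "\<bar>C\<bar>"]) auto
qed

lemma tendsto_pointwise:
  assumes "\<And>t. t > 0 \<Longrightarrow> F t \<in> X" "((\<lambda>t. N (F t)) \<longlongrightarrow> 0) (at_right (0::real))" "z \<in> unit_disk"
  shows "((\<lambda>t. F t z) \<longlongrightarrow> 0) (at_right 0)"
proof -
  obtain C K where CK: "\<And>f z. f \<in> X \<Longrightarrow> z \<in> unit_disk \<Longrightarrow> cmod (f z) \<le> N f * (C * (1 - (cmod z)\<^sup>2) powr (- K))"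
    using pointwise_growth by metis
  show ?thesis
  proof (rule Lim_null_comparison)
    show "\<forall>\<^sub>F t in at_right 0. norm (F t z) \<le> N (F t) * (C * (1 - (cmod z)\<^sup>2) powr (- K))"
      using CK[OF assms(1) assms(3)] by (auto intro: eventually_mono[OF eventually_at_right_less])
    show "((\<lambda>t. N (F t) * (C * (1 - (cmod z)\<^sup>2) powr (- K))) \<longlongrightarrow> 0) (at_right 0)"
      by (rule tendsto_mult_left_zero[OF assms(2)])
  qed
qed

end

section \<open>The Koenigs function and its inverse\<close>

locale koenigs_domain =
  fixes \<phi> :: "real \<Rightarrow> complex \<Rightarrow> complex" and h :: "complex \<Rightarrow> complex" and \<Omega> :: "complex set"
  assumes semigroup: "holomorphic_semigroup \<phi>" and koenigs: "koenigs_function \<phi> h"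
    and Omega: "\<Omega> = h ` unit_disk"
begin

lemma holo_h: "h holomorphic_on unit_disk" and inj_h: "inj_on h unit_disk"
  and h_flow: "t \<ge> 0 \<Longrightarrow> z \<in> unit_disk \<Longrightarrow> h (\<phi> t z) = h z + of_real t"
  using koenigs by (auto simp: koenigs_function_def)

lemma flow_in_disk: "t \<ge> 0 \<Longrightarrow> z \<in> unit_disk \<Longrightarrow> \<phi> t z \<in> unit_disk"
  using semigroup unfolding holomorphic_semigroup_def by blast

lemma open_Omega: "open \<Omega>"
  unfolding Omega by (rule open_mapping_thm3[OF holo_h _ inj_h]) simp

lemma connected_Omega: "connected \<Omega>"
  unfolding Omega
  by (intro connected_continuous_image holomorphic_on_imp_continuous_on holo_h) simp

lemma translate_in_Omega: "w \<in> \<Omega> \<Longrightarrow> t \<ge> 0 \<Longrightarrow> w + of_real t \<in> \<Omega>"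
  unfolding Omega by (auto simp: h_flow[symmetric] intro!: imageI flow_in_disk)

definition koenigs_inv :: "complex \<Rightarrow> complex" where "koenigs_inv = inv_into unit_disk h"

lemma koenigs_inv_h [simp]: "z \<in> unit_disk \<Longrightarrow> koenigs_inv (h z) = z"
  unfolding koenigs_inv_def by (rule inv_into_f_f[OF inj_h])

lemma h_koenigs_inv [simp]: "w \<in> \<Omega> \<Longrightarrow> h (koenigs_inv w) = w"
  unfolding koenigs_inv_def Omega by (rule f_inv_into_f)

lemma koenigs_inv_in_disk: "w \<in> \<Omega> \<Longrightarrow> koenigs_inv w \<in> unit_disk"
  unfolding koenigs_inv_def Omega by (rule inv_into_into)

lemma holo_koenigs_inv: "koenigs_inv holomorphic_on \<Omega>"
proof -
  obtain k where k: "k holomorphic_on (h ` unit_disk)" "\<And>z. z \<in> unit_disk \<Longrightarrow> k (h z) = z"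
    using holomorphic_has_inverse[OF holo_h _ inj_h] by (metis open_ball)
  have "k w = koenigs_inv w" if "w \<in> \<Omega>" for w
    using k(2)[OF koenigs_inv_in_disk[OF that]] that by simp
  thus ?thesis using k(1) holomorphic_transform Omega by blast
qed

end

section \<open>Slow approach to the boundary along rays\<close>

text \<open>Schwarz's lemma for \<open>g\<close>, precomposed with the affine map of the unit disc onto \<open>ball w R\<close> and
  postcomposed with the automorphism that sends \<open>g w\<close> to \<open>0\<close>, whose derivative at \<open>g w\<close> is
  \<open>1 / (1 - \<bar>g w\<bar>\<^sup>2)\<close>.\<close>

lemma schwarz_pick_center:
  assumes holo: "g holomorphic_on ball w R" and into: "g ` ball w R \<subseteq> unit_disk" and R: "R > 0"
  shows "R * cmod (deriv g w) \<le> 1 - (cmod (g w))\<^sup>2"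
proof -
  define a where "a = g w"
  have "w \<in> ball w R" using R by simp
  hence "g w \<in> unit_disk" using into by blast
  hence a: "cmod a < 1" by (simp add: a_def)
  define F where "F = Moebius_function 0 a \<circ> (g \<circ> (\<lambda>\<zeta>. w + of_real R * \<zeta>))"
  have inb: "w + of_real R * \<zeta> \<in> ball w R" if "cmod \<zeta> < 1" for \<zeta>
    using that R by (simp add: dist_norm norm_mult)
  have holF: "F holomorphic_on unit_disk"
    unfolding F_def
  proof (intro holomorphic_on_compose_gen)
    show "(\<lambda>\<zeta>. w + of_real R * \<zeta>) ` unit_disk \<subseteq> ball w R" using inb by auto
    show "g holomorphic_on ball w R" by fact
    show "Moebius_function 0 a holomorphic_on unit_disk" by (rule Moebius_function_holomorphic[OF a])
    show "(g \<circ> (\<lambda>\<zeta>. w + of_real R * \<zeta>)) ` unit_disk \<subseteq> unit_disk"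
      using inb into by force
  qed (intro holomorphic_intros)
  have F0: "F 0 = 0" by (simp add: F_def a_def Moebius_function_eq_zero)
  have F1: "cmod (F \<zeta>) < 1" if "cmod \<zeta> < 1" for \<zeta>
  proof -
    have "g (w + of_real R * \<zeta>) \<in> unit_disk" using inb[OF that] into by blast
    thus ?thesis unfolding F_def o_def by (intro Moebius_function_norm_lt_1 a) simp
  qed
  define d where "d = 1 - (cmod a)\<^sup>2"
  have d: "d > 0" using disk_defect_bounds(1)[of a] a by (simp add: d_def)
  have cd: "1 - cnj a * a = of_real d"
    using complex_norm_square[of a] by (simp add: d_def mult.commute)
  have D1: "((\<lambda>z. (z - a) / (1 - cnj a * z)) has_field_derivative 1 / of_real d) (at a)"
  proof -
    have nz: "1 - cnj a * a \<noteq> 0" using d cd by simp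
    hence "((\<lambda>z. (z - a) / (1 - cnj a * z)) has_field_derivative 1 / (1 - cnj a * a)) (at a)"
      by (auto intro!: derivative_eq_intros)
    thus ?thesis by (simp only: cd)
  qed
  have "(g has_field_derivative deriv g w) (at w)"
    using holo R by (intro holomorphic_derivI[OF holo]) auto
  hence D2: "((\<lambda>\<zeta>. g (w + of_real R * \<zeta>)) has_field_derivative deriv g w * of_real R) (at 0)"
    by (intro DERIV_chain2[where f = g]) (auto intro!: derivative_eq_intros)
  have "((\<lambda>\<zeta>. (g (w + of_real R * \<zeta>) - a) / (1 - cnj a * g (w + of_real R * \<zeta>)))
      has_field_derivative 1 / of_real d * (deriv g w * of_real R)) (at 0)"
    by (rule DERIV_chain2[OF _ D2, where f = "\<lambda>z. (z - a) / (1 - cnj a * z)"]) (use D1 in \<open>simp add: a_def\<close>)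
  moreover have "F = (\<lambda>\<zeta>. (g (w + of_real R * \<zeta>) - a) / (1 - cnj a * g (w + of_real R * \<zeta>)))"
    by (simp add: F_def fun_eq_iff Moebius_function_simple)
  ultimately have "deriv F 0 = 1 / of_real d * (deriv g w * of_real R)"
    by (simp add: DERIV_imp_deriv)
  moreover have "cmod (deriv F 0) \<le> 1"
    by (rule Schwarz_Lemma(2)[OF holF F0 F1, of 0]) auto
  moreover have "cmod (1 / of_real d * (deriv g w * of_real R)) = R * cmod (deriv g w) / d"
    using d R by (simp add: norm_mult norm_divide)
  ultimately have "R * cmod (deriv g w) \<le> d" using d by simp
  thus ?thesis by (simp add: d_def a_def)
qed

text \<open>By Schwarz-Pick, \<open>u s = 1 - \<bar>g (w0 + s v)\<bar>\<^sup>2\<close> satisfies \<open>u' \<ge> - (2 / R) u\<close>, so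
  \<open>exp (2 s / R) * u s\<close> is nondecreasing.\<close>

lemma defect_decay_along_ray:
  assumes holo: "g holomorphic_on \<Omega>" and op: "open \<Omega>" and into: "g ` \<Omega> \<subseteq> unit_disk"
    and v: "cmod v = 1" and R: "R > 0"
    and balls: "\<And>s. s \<ge> s0 \<Longrightarrow> ball (w0 + of_real s * v) R \<subseteq> \<Omega>"
  obtains c where "c > 0" "\<And>s. s \<ge> s0 \<Longrightarrow> c * exp (- (2 / R) * s) \<le> 1 - (cmod (g (w0 + of_real s * v)))\<^sup>2"
proof -
  define \<gamma> where "\<gamma> s = g (w0 + of_real s * v)" for s
  define \<gamma>' where "\<gamma>' s = v * deriv g (w0 + of_real s * v)" for s
  define u where "u s = 1 - (cmod (\<gamma> s))\<^sup>2" for s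
  define q where "q s = exp ((2 / R) * s) * u s" for s
  have inO: "w0 + of_real s * v \<in> \<Omega>" if "s \<ge> s0" for s
    using balls[OF that] R by auto
  have upos: "u s > 0" if "s \<ge> s0" for s
    unfolding u_def \<gamma>_def using inO[OF that] into by (intro disk_defect_bounds(1)) auto
  have d\<gamma>: "(\<gamma> has_vector_derivative \<gamma>' s) (at s)" if "s \<ge> s0" for s
  proof -
    have "(g has_field_derivative deriv g (w0 + of_real s * v)) (at (w0 + of_real s * v))"
      by (rule holomorphic_derivI[OF holo op inO[OF that]])
    moreover have "((\<lambda>s. w0 + of_real s * v) has_vector_derivative v) (at s)"
      by (auto intro!: derivative_eq_intros)
    ultimately have "((g \<circ> (\<lambda>s. w0 + of_real s * v)) has_vector_derivative v * deriv g (w0 + of_real s * v)) (at s)"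
      by (intro field_vector_diff_chain_at)
    thus ?thesis by (simp add: \<gamma>_def[abs_def] \<gamma>'_def o_def)
  qed
  have du: "(u has_real_derivative - 2 * (\<gamma> s \<bullet> \<gamma>' s)) (at s)" if "s \<ge> s0" for s
  proof -
    have "((\<lambda>s. \<gamma> s \<bullet> \<gamma> s) has_vector_derivative (\<gamma> s \<bullet> \<gamma>' s + \<gamma>' s \<bullet> \<gamma> s)) (at s)"
      by (rule bounded_bilinear.has_vector_derivative[OF bounded_bilinear_inner d\<gamma>[OF that] d\<gamma>[OF that]])
    hence "((\<lambda>s. \<gamma> s \<bullet> \<gamma> s) has_real_derivative 2 * (\<gamma> s \<bullet> \<gamma>' s)) (at s)"
      by (simp add: has_real_derivative_iff_has_vector_derivative inner_commute)
    hence "((\<lambda>s. 1 - \<gamma> s \<bullet> \<gamma> s) has_real_derivative - 2 * (\<gamma> s \<bullet> \<gamma>' s)) (at s)"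
      by (auto intro!: derivative_eq_intros)
    thus ?thesis by (simp add: u_def[abs_def] power2_norm_eq_inner)
  qed
  have dq: "(q has_real_derivative exp ((2 / R) * s) * ((2 / R) * u s - 2 * (\<gamma> s \<bullet> \<gamma>' s))) (at s)" if "s \<ge> s0" for s
    unfolding q_def[abs_def] using du[OF that] R by (auto intro!: derivative_eq_intros simp: algebra_simps)
  have sign: "0 \<le> (2 / R) * u s - 2 * (\<gamma> s \<bullet> \<gamma>' s)" if "s \<ge> s0" for s
  proof -
    have "R * cmod (\<gamma>' s) \<le> u s"
      unfolding \<gamma>'_def u_def \<gamma>_def norm_mult v using balls[OF that] into
      by (simp, intro schwarz_pick_center R holomorphic_on_subset[OF holo]) auto
    moreover have "\<gamma> s \<bullet> \<gamma>' s \<le> cmod (\<gamma>' s)"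
    proof -
      have "\<gamma> s \<bullet> \<gamma>' s \<le> cmod (\<gamma> s) * cmod (\<gamma>' s)" by (rule norm_cauchy_schwarz)
      also have "\<dots> \<le> 1 * cmod (\<gamma>' s)"
        using inO[OF that] into by (intro mult_right_mono) (auto simp: \<gamma>_def less_imp_le)
      finally show ?thesis by simp
    qed
    moreover have "cmod (\<gamma>' s) \<le> u s / R" using calculation(1) R by (simp add: field_simps)
    ultimately show ?thesis by simp
  qed
  have mono: "q s0 \<le> q s" if "s \<ge> s0" for s
  proof (rule DERIV_nonneg_imp_nondecreasing[OF that])
    fix x assume "s0 \<le> x" "x \<le> s"
    thus "\<exists>y. (q has_real_derivative y) (at x) \<and> 0 \<le> y"
      using dq[of x] sign[of x] by (intro exI conjI) auto
  qed
  show ?thesis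
  proof (rule that[of "q s0"])
    show "q s0 > 0" using upos[of s0] by (simp add: q_def)
    fix s assume s: "s \<ge> s0"
    have "q s0 * exp (- (2 / R) * s) \<le> q s * exp (- (2 / R) * s)"
      using mono[OF s] by (intro mult_right_mono) auto
    also have "\<dots> = u s" by (simp add: q_def exp_minus field_simps)
    finally show "q s0 * exp (- (2 / R) * s) \<le> 1 - (cmod (g (w0 + of_real s * v)))\<^sup>2"
      by (simp add: u_def \<gamma>_def)
  qed
qed

section \<open>Eigenvalues and exponentials of the Koenigs function\<close>

locale koenigs_space = koenigs_domain \<phi> h \<Omega> + disk_function_space X N
  for \<phi> h \<Omega> X N
begin

text \<open>Norm convergence of the difference quotients implies pointwise convergence, so \<open>F = f \<circ> h\<inverse>\<close> solves
  \<open>F' = \<mu> F\<close> on the connected open set \<open>\<Omega>\<close>. Its solutions are the multiples of \<open>exp (\<mu> w)\<close>.\<close>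

lemma eigenfunction_exponential:
  assumes z0: "z0 \<in> unit_disk" "f z0 \<noteq> 0" and gen: "has_generator_value X N \<phi> f (\<lambda>z. \<mu> * f z)"
  shows "(\<lambda>z. exp (\<mu> * h z)) \<in> X"
proof -
  have fX: "f \<in> X" and quot: "\<And>t. t > 0 \<Longrightarrow> (\<lambda>z. (f (\<phi> t z) - f z) / of_real t) \<in> X"
    and mX: "(\<lambda>z. \<mu> * f z) \<in> X"
    and lim: "((\<lambda>t. N (\<lambda>z. (f (\<phi> t z) - f z) / of_real t - \<mu> * f z)) \<longlongrightarrow> 0) (at_right 0)"
    using gen by (auto simp: has_generator_value_def)
  define F where "F = f \<circ> koenigs_inv"
  have holF: "F holomorphic_on \<Omega>"
    unfolding F_def using holo[OF fX] holo_koenigs_inv koenigs_inv_in_disk by (intro holomorphic_on_compose_gen) auto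
  have dF: "(F has_field_derivative \<mu> * F w) (at w)" if w: "w \<in> \<Omega>" for w
  proof -
    let ?z = "koenigs_inv w"
    have D: "(F has_field_derivative deriv F w) (at w)"
      by (rule holomorphic_derivI[OF holF open_Omega w])
    hence "((\<lambda>k. (F (w + k) - F w) / k) \<longlongrightarrow> deriv F w) (at 0)"
      by (simp add: DERIV_def)
    moreover have "filterlim (\<lambda>t. complex_of_real t) (at 0) (at_right 0)"
      unfolding filterlim_at
      by (auto intro!: tendsto_eq_intros eventually_mono[OF eventually_at_right_less])
    ultimately have 1: "((\<lambda>t. (F (w + of_real t) - F w) / of_real t) \<longlongrightarrow> deriv F w) (at_right 0)"
      by (rule filterlim_compose)
    have "((\<lambda>t. (f (\<phi> t ?z) - f ?z) / of_real t - \<mu> * f ?z) \<longlongrightarrow> 0) (at_right 0)"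
      by (rule tendsto_pointwise[OF _ lim koenigs_inv_in_disk[OF w]]) (rule diff[OF quot mX])
    hence "((\<lambda>t. (f (\<phi> t ?z) - f ?z) / of_real t) \<longlongrightarrow> \<mu> * f ?z) (at_right 0)"
      by (simp add: LIM_zero_iff)
    \<comment> \<open>The generator is a derivative along the flow, and the flow is translation in the Koenigs domain.\<close>
    moreover have "f (\<phi> t ?z) = F (w + of_real t)" if "t > 0" for t
    proof -
      have "\<phi> t ?z = koenigs_inv (h (\<phi> t ?z))" using flow_in_disk[OF less_imp_le[OF that] koenigs_inv_in_disk[OF w]] by simp
      also have "h (\<phi> t ?z) = w + of_real t" using h_flow[OF less_imp_le[OF that] koenigs_inv_in_disk[OF w]] w by simp
      finally show ?thesis by (simp add: F_def)
    qed
    hence "\<forall>\<^sub>F t in at_right 0. (f (\<phi> t ?z) - f ?z) / of_real t = (F (w + of_real t) - F w) / of_real t"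
      by (intro eventually_mono[OF eventually_at_right_less]) (simp add: F_def)
    ultimately have "((\<lambda>t. (F (w + of_real t) - F w) / of_real t) \<longlongrightarrow> \<mu> * f ?z) (at_right 0)"
      by (rule Lim_transform_eventually)
    from tendsto_unique[OF _ 1 this] have "deriv F w = \<mu> * F w" by (simp add: F_def)
    thus ?thesis using D by simp
  qed
  have "(\<lambda>w. F w * exp (- \<mu> * w)) constant_on \<Omega>"
  proof (rule DERIV_zero_connected_constant_on[OF connected_Omega open_Omega, of "{}"])
    show "continuous_on \<Omega> (\<lambda>w. F w * exp (- \<mu> * w))"
      by (intro continuous_intros holomorphic_on_imp_continuous_on holF)
    show "\<forall>w\<in>\<Omega> - {}. ((\<lambda>w. F w * exp (- \<mu> * w)) has_field_derivative 0) (at w)"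
      by (auto intro!: derivative_eq_intros dF)
  qed auto
  then obtain c where c: "\<And>w. w \<in> \<Omega> \<Longrightarrow> F w * exp (- \<mu> * w) = c"
    unfolding constant_on_def by blast
  have f_eq: "f z = c * exp (\<mu> * h z)" if "z \<in> unit_disk" for z
  proof -
    have "f z * exp (- \<mu> * h z) = c"
      using c[of "h z"] that by (simp add: F_def Omega)
    thus ?thesis by (auto simp: exp_minus field_simps)
  qed
  have "c \<noteq> 0" using f_eq[OF z0(1)] z0(2) by auto
  show ?thesis
    by (rule cong[OF scale[OF fX, of "1 / c"]]) (use f_eq \<open>c \<noteq> 0\<close> in auto)
qed

text \<open>The difference quotient of \<open>exp (\<mu> h)\<close> is the function itself times a scalar that tends to \<open>\<mu>\<close>.\<close>

lemma exponential_eigenfunction: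
  assumes fX: "(\<lambda>z. exp (\<mu> * h z)) \<in> X"
  shows "has_generator_value X N \<phi> (\<lambda>z. exp (\<mu> * h z)) (\<lambda>z. \<mu> * exp (\<mu> * h z))"
proof -
  let ?f = "\<lambda>z. exp (\<mu> * h z)"
  define a where "a t = (exp (\<mu> * of_real t) - 1) / of_real t" for t :: real
  have quot: "(?f (\<phi> t z) - ?f z) / of_real t = a t * ?f z" if "t > 0" "z \<in> unit_disk" for t z
    using h_flow[of t z] that by (simp add: a_def exp_add algebra_simps diff_divide_distrib)
  have alim: "(a \<longlongrightarrow> \<mu>) (at_right 0)"
  proof -
    have "((\<lambda>k. exp (\<mu> * k)) has_field_derivative \<mu>) (at 0)"
      by (auto intro!: derivative_eq_intros)
    hence "((\<lambda>k. (exp (\<mu> * k) - 1) / k) \<longlongrightarrow> \<mu>) (at 0)" by (simp add: DERIV_def)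
    moreover have "filterlim (\<lambda>t. complex_of_real t) (at 0) (at_right 0)"
      unfolding filterlim_at
      by (auto intro!: tendsto_eq_intros eventually_mono[OF eventually_at_right_less])
    ultimately show ?thesis unfolding a_def[abs_def] by (rule filterlim_compose)
  qed
  have "((\<lambda>t. N (\<lambda>z. (?f (\<phi> t z) - ?f z) / of_real t - \<mu> * ?f z)) \<longlongrightarrow> 0) (at_right 0)"
  proof (rule tendsto_sandwich)
    show "\<forall>\<^sub>F t in at_right 0. 0 \<le> N (\<lambda>z. (?f (\<phi> t z) - ?f z) / of_real t - \<mu> * ?f z)"
      by (simp add: norm_nonneg)
    show "\<forall>\<^sub>F t in at_right 0. N (\<lambda>z. (?f (\<phi> t z) - ?f z) / of_real t - \<mu> * ?f z) \<le> cmod (a t - \<mu>) * N ?f"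
    proof (rule eventually_mono[OF eventually_at_right_less])
      fix t :: real assume t: "0 < t"
      have "N (\<lambda>z. (?f (\<phi> t z) - ?f z) / of_real t - \<mu> * ?f z) = N (\<lambda>z. (a t - \<mu>) * ?f z)"
        by (rule norm_cong) (simp add: quot[OF t] algebra_simps)
      thus "N (\<lambda>z. (?f (\<phi> t z) - ?f z) / of_real t - \<mu> * ?f z) \<le> cmod (a t - \<mu>) * N ?f"
        using norm_scale[OF fX] by simp
    qed
    show "((\<lambda>t. cmod (a t - \<mu>) * N ?f) \<longlongrightarrow> 0) (at_right 0)"
      using alim by (intro tendsto_mult_left_zero tendsto_norm_zero) (simp add: LIM_zero_iff)
  qed simp
  thus ?thesis
    unfolding has_generator_value_def
    using fX scale[OF fX] by (auto intro: cong[OF scale[OF fX]] quot)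
qed

lemma point_spectrum_iff: "\<mu> \<in> generator_point_spectrum X N \<phi> \<longleftrightarrow> (\<lambda>z. exp (\<mu> * h z)) \<in> X"
proof
  assume "(\<lambda>z. exp (\<mu> * h z)) \<in> X"
  thus "\<mu> \<in> generator_point_spectrum X N \<phi>"
    unfolding generator_point_spectrum_def using exponential_eigenfunction
    by (intro CollectI exI[of _ "\<lambda>z. exp (\<mu> * h z)"] conjI bexI[of _ 0]) auto
qed (auto simp: generator_point_spectrum_def intro: eigenfunction_exponential)

text \<open>Suppose \<open>\<delta> = Re (\<mu> v)\<close> were positive. Growth of order \<open>K\<close> and the decay of the defect bound
  \<open>exp (\<delta> s)\<close> by a multiple of \<open>exp (2 K s / R)\<close> along the ray, for every \<open>R\<close>. A radius with
  \<open>2 K / R < \<delta>\<close> is a contradiction.\<close>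

lemma spectrum_direction_le:
  assumes \<mu>: "\<mu> \<in> generator_point_spectrum X N \<phi>" and v: "cmod v = 1"
    and wide: "\<And>R. R > 0 \<Longrightarrow> \<exists>s0. \<forall>s\<ge>s0. ball (w0 + of_real s * v) R \<subseteq> \<Omega>"
  shows "Re (\<mu> * v) \<le> 0"
proof (rule ccontr)
  define \<delta> where "\<delta> = Re (\<mu> * v)"
  let ?f = "\<lambda>z. exp (\<mu> * h z)"
  assume "\<not> Re (\<mu> * v) \<le> 0"
  hence \<delta>: "\<delta> > 0" by (simp add: \<delta>_def)
  obtain C K where K: "K \<ge> 0" and
    CK: "\<And>f z. f \<in> X \<Longrightarrow> z \<in> unit_disk \<Longrightarrow> cmod (f z) \<le> N f * (C * (1 - (cmod z)\<^sup>2) powr (- K))"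
    using pointwise_growth by metis
  \<comment> \<open>Chosen such that \<open>2 * K / R = \<delta> * K / (K + 1) < \<delta>\<close>, also when \<open>K = 0\<close>.\<close>
  define R where "R = 2 * (K + 1) / \<delta>"
  have R: "R > 0" using K \<delta> by (simp add: R_def)
  obtain s0 where s0: "\<And>s. s \<ge> s0 \<Longrightarrow> ball (w0 + of_real s * v) R \<subseteq> \<Omega>"
    using wide[OF R] by blast
  obtain c where c: "c > 0"
    and decay: "\<And>s. s \<ge> s0 \<Longrightarrow> c * exp (- (2 / R) * s) \<le> 1 - (cmod (koenigs_inv (w0 + of_real s * v)))\<^sup>2"
    using defect_decay_along_ray[OF holo_koenigs_inv open_Omega _ v R s0] koenigs_inv_in_disk by blast
  define \<epsilon> where "\<epsilon> = \<delta> - 2 / R * K"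
  have \<epsilon>: "\<epsilon> > 0" using \<delta> K by (simp add: \<epsilon>_def R_def field_simps)
  define M where "M = N ?f * \<bar>C\<bar> * c powr (- K) / exp (Re (\<mu> * w0))"
  have bound: "exp (\<epsilon> * s) \<le> M" if s: "s \<ge> s0" for s
  proof -
    define w where "w = w0 + of_real s * v"
    define x where "x = c * exp (- (2 / R) * s)"
    have w: "w \<in> \<Omega>" using s0[OF s] R by (auto simp: w_def)
    have x: "x > 0" using c by (simp add: x_def)
    have "exp (Re (\<mu> * w0) + \<delta> * s) = cmod (?f (koenigs_inv w))"
      using w by (simp add: w_def \<delta>_def algebra_simps)
    also have "\<dots> \<le> N ?f * (C * (1 - (cmod (koenigs_inv w))\<^sup>2) powr (- K))"
      using \<mu> koenigs_inv_in_disk[OF w] by (intro CK) (auto simp: point_spectrum_iff)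
    also have "\<dots> \<le> N ?f * (\<bar>C\<bar> * x powr (- K))"
      using decay[OF s] K x norm_nonneg
      by (intro mult_left_mono mult_mono powr_mono2') (auto simp: w_def x_def)
    also have "x powr (- K) = c powr (- K) * exp (2 / R * K * s)"
      using c by (simp add: x_def powr_mult exp_powr_real mult_ac)
    finally have "exp (Re (\<mu> * w0)) * exp (\<delta> * s) \<le> N ?f * \<bar>C\<bar> * c powr (- K) * exp (2 / R * K * s)"
      by (simp add: exp_add mult_ac)
    hence "exp (\<delta> * s) * exp (- (2 / R * K * s)) \<le> M"
      by (simp add: M_def exp_minus field_simps)
    thus ?thesis by (simp add: \<epsilon>_def exp_add[symmetric] algebra_simps)
  qed
  define s where "s = max s0 (M / \<epsilon>)"
  have "M \<le> \<epsilon> * s" using \<epsilon> by (simp add: s_def field_simps max_def)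
  also have "\<dots> < exp (\<epsilon> * s)" using exp_ge_add_one_self[of "\<epsilon> * s"] by linarith
  finally show False using bound[of s] by (simp add: s_def)
qed

end

section \<open>Sectors and the inner and outer arguments\<close>

text \<open>A half-plane has the form \<open>{w. Im (w * a) > c}\<close>. A ray whose direction points into it ends up
  inside, together with discs of any fixed radius, because \<open>Im (w * a)\<close> grows linearly along the
  ray. Sectors of opening at most \<open>\<pi>\<close> are intersections of two half-planes, which is what the next
  lemmas use.\<close>

lemma ray_enters_half_plane:
  assumes "Im (v * a) > 0"
  obtains s0 where "\<And>s w. s \<ge> s0 \<Longrightarrow> dist (q + of_real s * v) w < R \<Longrightarrow> Im (w * a) > c"
proof
  define s0 where "s0 = (c + R * cmod a - Im (q * a)) / Im (v * a)"
  fix s w assume s: "s \<ge> s0" and w: "dist (q + of_real s * v) w < R"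
  define e where "e = q + of_real s * v - w"
  have "Im (e * a) \<le> cmod e * cmod a" using abs_Im_le_cmod[of "e * a"] by (simp add: norm_mult)
  also have "\<dots> < R * cmod a"
    using w assms by (intro mult_strict_right_mono) (auto simp: e_def dist_norm)
  also have "R * cmod a \<le> s * Im (v * a) + Im (q * a) - c"
    using s assms by (simp add: s0_def field_simps)
  also have "s * Im (v * a) + Im (q * a) = Im (e * a) + Im (w * a)"
    by (simp add: e_def algebra_simps)
  finally show "Im (w * a) > c" by simp
qed

lemma Im_times_cis: "Im (w * cis t) = cmod w * sin (Arg w + t)"
proof -
  have "w * cis t = rcis (cmod w) (Arg w + t)"
    by (metis cis_rcis_eq mult.right_neutral rcis_cmod_Arg rcis_mult)
  thus ?thesis by simp
qed

lemma lower_sector_iff: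
  assumes "0 < \<theta>" "\<theta> \<le> pi"
  shows "w \<in> sector (- \<theta>) 0 \<longleftrightarrow> Im w < 0 \<and> Im (w * cis \<theta>) > 0"
proof (cases "Im w < 0")
  case True
  hence A: "Arg w < 0" "- pi < Arg w" and w: "cmod w > 0" "w \<noteq> 0" by (auto simp: Arg_neg_iff mpi_less_Arg)
  have "sin (Arg w + \<theta>) > 0 \<longleftrightarrow> - \<theta> < Arg w"
  proof
    assume "- \<theta> < Arg w"
    thus "sin (Arg w + \<theta>) > 0" using A assms by (intro sin_gt_zero) auto
  next
    assume "sin (Arg w + \<theta>) > 0"
    thus "- \<theta> < Arg w" using A assms sin_ge_zero[of "- (Arg w + \<theta>)"] by (smt (verit) sin_minus)
  qed
  hence "Im (w * cis \<theta>) > 0 \<longleftrightarrow> - \<theta> < Arg w"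
    unfolding Im_times_cis using w by (simp add: zero_less_mult_iff)
  thus ?thesis using True A w by (simp add: sector_def del: times_complex.sel)
qed (auto simp: sector_def Arg_neg_iff)

lemma upper_sector_iff:
  assumes "0 < \<theta>" "\<theta> \<le> pi"
  shows "w \<in> sector 0 \<theta> \<longleftrightarrow> Im w > 0 \<and> Im (w * cis (- \<theta>)) < 0"
proof (cases "Im w > 0")
  case True
  hence A: "Arg w > 0" "Arg w < pi" and w: "cmod w > 0" "w \<noteq> 0" using Arg_lt_pi[of w] by auto
  have "sin (Arg w - \<theta>) < 0 \<longleftrightarrow> Arg w < \<theta>"
  proof
    assume "Arg w < \<theta>"
    thus "sin (Arg w - \<theta>) < 0" using A assms sin_gt_zero[of "\<theta> - Arg w"] by (smt (verit) sin_minus)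
  next
    assume "sin (Arg w - \<theta>) < 0"
    thus "Arg w < \<theta>" using A assms sin_ge_zero[of "Arg w - \<theta>"] by (smt (verit))
  qed
  hence "Im (w * cis (- \<theta>)) < 0 \<longleftrightarrow> Arg w < \<theta>"
    unfolding Im_times_cis using w by (simp add: mult_less_0_iff)
  thus ?thesis using True A w by (simp add: sector_def del: times_complex.sel)
next
  case False
  hence "\<not> (0 < Arg w \<and> Arg w < \<theta>)" using Arg_lt_pi[of w] assms by auto
  thus ?thesis using False by (auto simp: sector_def)
qed

lemma lower_part_iff: "w \<in> lower_part \<Omega> \<longleftrightarrow> w \<in> \<Omega> \<and> Im w < 0"
  by (auto simp: lower_part_def sector_def Arg_neg_iff mpi_less_Arg)

lemma upper_part_iff: "w \<in> upper_part \<Omega> \<longleftrightarrow> w \<in> \<Omega> \<and> Im w > 0"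
  by (auto simp: upper_part_def sector_def Arg_lt_pi)

lemma translate_image_iff: "w \<in> (+) q ` S \<longleftrightarrow> w - q \<in> S" for w :: complex
  by (auto simp: image_iff) (metis add_diff_cancel_left' diff_add_cancel add.commute)

lemma lower_sector_absorbs_ray:
  assumes "0 < \<psi>" "\<psi> < \<theta>" "\<theta> \<le> pi"
  obtains s0 where "\<And>s. s \<ge> s0 \<Longrightarrow> ball (q + of_real s * cis (- \<psi>)) R \<subseteq> (+) q ` sector (- \<theta>) 0"
proof -
  have a: "Im (cis (- \<psi>) * (- 1)) > 0" using assms by (simp add: sin_gt_zero)
  have b: "Im (cis (- \<psi>) * cis \<theta>) > 0" using assms by (simp add: cis_mult sin_gt_zero)
  obtain s1 where s1: "\<And>s w. s \<ge> s1 \<Longrightarrow> dist (q + of_real s * cis (- \<psi>)) w < R \<Longrightarrow> Im (w * (- 1)) > Im (q * (- 1))"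
    using ray_enters_half_plane[OF a] by blast
  obtain s2 where s2: "\<And>s w. s \<ge> s2 \<Longrightarrow> dist (q + of_real s * cis (- \<psi>)) w < R \<Longrightarrow> Im (w * cis \<theta>) > Im (q * cis \<theta>)"
    using ray_enters_half_plane[OF b] by blast
  show ?thesis
  proof (rule that[of "max s1 s2"], rule subsetI)
    fix s w assume s: "s \<ge> max s1 s2" and w: "w \<in> ball (q + of_real s * cis (- \<psi>)) R"
    have "Im (w - q) < 0" using s1[of s w] s w by simp
    moreover have "Im ((w - q) * cis \<theta>) > 0" using s2[of s w] s w by (simp add: left_diff_distrib)
    ultimately show "w \<in> (+) q ` sector (- \<theta>) 0"
      using assms by (simp add: translate_image_iff lower_sector_iff)
  qed
qed

lemma upper_sector_absorbs_ray:
  assumes "0 < \<psi>" "\<psi> < \<theta>" "\<theta> \<le> pi"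
  obtains s0 where "\<And>s. s \<ge> s0 \<Longrightarrow> ball (q + of_real s * cis \<psi>) R \<subseteq> (+) q ` sector 0 \<theta>"
proof -
  have a: "Im (cis \<psi> * 1) > 0" using assms by (simp add: sin_gt_zero)
  have b: "Im (cis \<psi> * (- cis (- \<theta>))) > 0"
    using assms sin_gt_zero[of "\<theta> - \<psi>"] sin_minus[of "\<theta> - \<psi>"] by (simp add: cis_mult)
  obtain s1 where s1: "\<And>s w. s \<ge> s1 \<Longrightarrow> dist (q + of_real s * cis \<psi>) w < R \<Longrightarrow> Im (w * 1) > Im (q * 1)"
    using ray_enters_half_plane[OF a] by blast
  obtain s2 where s2: "\<And>s w. s \<ge> s2 \<Longrightarrow> dist (q + of_real s * cis \<psi>) w < R \<Longrightarrow>
      Im (w * (- cis (- \<theta>))) > Im (q * (- cis (- \<theta>)))"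
    using ray_enters_half_plane[OF b] by blast
  show ?thesis
  proof (rule that[of "max s1 s2"], rule subsetI)
    fix s w assume s: "s \<ge> max s1 s2" and w: "w \<in> ball (q + of_real s * cis \<psi>) R"
    have "Im (w - q) > 0" using s1[of s w] s w by simp
    moreover have "Im ((w - q) * cis (- \<theta>)) < 0" using s2[of s w] s w by (simp add: algebra_simps)
    ultimately show "w \<in> (+) q ` sector 0 \<theta>"
      using assms by (simp add: translate_image_iff upper_sector_iff)
  qed
qed

text \<open>An interior ray of the inner sector whose direction lies outside the outer sector would leave it.\<close>

lemma lower_sector_subset_le:
  assumes sub: "(+) q ` sector (- \<theta>) 0 \<subseteq> (+) q' ` sector (- \<theta>') 0"
    and \<theta>: "\<theta> \<in> {0<..pi}" and \<theta>': "\<theta>' \<in> {0<..pi}"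
  shows "\<theta> \<le> \<theta>'"
proof (rule ccontr)
  assume "\<not> \<theta> \<le> \<theta>'"
  define \<psi> where "\<psi> = (\<theta> + \<theta>') / 2"
  have \<psi>: "\<theta>' < \<psi>" "\<psi> < \<theta>" "0 < \<psi>" using \<open>\<not> \<theta> \<le> \<theta>'\<close> \<theta>' by (auto simp: \<psi>_def)
  obtain s1 where s1: "\<And>s. s \<ge> s1 \<Longrightarrow> ball (q + of_real s * cis (- \<psi>)) 1 \<subseteq> (+) q ` sector (- \<theta>) 0"
    using lower_sector_absorbs_ray[of \<psi> \<theta> q 1] \<psi> \<theta> by auto
  have b: "Im (cis (- \<psi>) * (- cis \<theta>')) > 0"
    using \<psi> \<theta> \<theta>' sin_gt_zero[of "\<psi> - \<theta>'"] sin_minus[of "\<psi> - \<theta>'"] by (simp add: cis_mult)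
  obtain s2 where s2: "\<And>s w. s \<ge> s2 \<Longrightarrow> dist (q + of_real s * cis (- \<psi>)) w < 1 \<Longrightarrow>
      Im (w * (- cis \<theta>')) > Im (q' * (- cis \<theta>'))"
    using ray_enters_half_plane[OF b] by blast
  define w where "w = q + of_real (max s1 s2) * cis (- \<psi>)"
  have "w \<in> ball (q + of_real (max s1 s2) * cis (- \<psi>)) 1" by (simp add: w_def)
  hence "w - q' \<in> sector (- \<theta>') 0" using s1[of "max s1 s2"] sub by (force simp: translate_image_iff)
  hence "Im ((w - q') * cis \<theta>') > 0" using \<theta>' by (simp add: lower_sector_iff)
  moreover have "Im (w * (- cis \<theta>')) > Im (q' * (- cis \<theta>'))"
    using s2[of "max s1 s2" w] by (simp add: w_def)
  ultimately show False by (simp add: algebra_simps)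
qed

lemma upper_sector_subset_le:
  assumes sub: "(+) q ` sector 0 \<theta> \<subseteq> (+) q' ` sector 0 \<theta>'"
    and \<theta>: "\<theta> \<in> {0<..pi}" and \<theta>': "\<theta>' \<in> {0<..pi}"
  shows "\<theta> \<le> \<theta>'"
proof (rule ccontr)
  assume "\<not> \<theta> \<le> \<theta>'"
  define \<psi> where "\<psi> = (\<theta> + \<theta>') / 2"
  have \<psi>: "\<theta>' < \<psi>" "\<psi> < \<theta>" "0 < \<psi>" using \<open>\<not> \<theta> \<le> \<theta>'\<close> \<theta>' by (auto simp: \<psi>_def)
  obtain s1 where s1: "\<And>s. s \<ge> s1 \<Longrightarrow> ball (q + of_real s * cis \<psi>) 1 \<subseteq> (+) q ` sector 0 \<theta>"
    using upper_sector_absorbs_ray[of \<psi> \<theta> q 1] \<psi> \<theta> by auto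
  have b: "Im (cis \<psi> * cis (- \<theta>')) > 0"
    using \<psi> \<theta> \<theta>' sin_gt_zero[of "\<psi> - \<theta>'"] by (simp add: cis_mult)
  obtain s2 where s2: "\<And>s w. s \<ge> s2 \<Longrightarrow> dist (q + of_real s * cis \<psi>) w < 1 \<Longrightarrow>
      Im (w * cis (- \<theta>')) > Im (q' * cis (- \<theta>'))"
    using ray_enters_half_plane[OF b] by blast
  define w where "w = q + of_real (max s1 s2) * cis \<psi>"
  have "w \<in> ball (q + of_real (max s1 s2) * cis \<psi>) 1" by (simp add: w_def)
  hence "w - q' \<in> sector 0 \<theta>'" using s1[of "max s1 s2"] sub by (force simp: translate_image_iff)
  hence "Im ((w - q') * cis (- \<theta>')) < 0" using \<theta>' by (simp add: upper_sector_iff)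
  moreover have "Im (w * cis (- \<theta>')) > Im (q' * cis (- \<theta>'))"
    using s2[of "max s1 s2" w] by (simp add: w_def)
  ultimately show False by (simp add: algebra_simps)
qed

lemma lower_inner_nonneg: "0 \<le> lower_inner_arg \<Omega>"
  unfolding lower_inner_arg_def by (rule cSup_upper) (auto intro!: bdd_aboveI[of _ pi])

lemma upper_inner_nonneg: "0 \<le> upper_inner_arg \<Omega>"
  unfolding upper_inner_arg_def by (rule cSup_upper) (auto intro!: bdd_aboveI[of _ pi])

lemma less_lower_innerE:
  assumes "x < lower_inner_arg \<Omega>" "0 \<le> x"
  obtains \<theta> q where "\<theta> \<in> {0<..pi}" "x < \<theta>" "(+) q ` sector (- \<theta>) 0 \<subseteq> lower_part \<Omega>"
proof -
  have "\<exists>\<theta>\<in>{0} \<union> {\<theta> \<in> {0<..pi}. \<exists>q. (+) q ` sector (- \<theta>) 0 \<subseteq> lower_part \<Omega>}. x < \<theta>"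
    using assms unfolding lower_inner_arg_def
    by (subst (asm) less_cSup_iff) (auto intro!: bdd_aboveI[of _ pi])
  then obtain \<theta> where "x < \<theta>" "\<theta> = 0 \<or> \<theta> \<in> {0<..pi} \<and> (\<exists>q. (+) q ` sector (- \<theta>) 0 \<subseteq> lower_part \<Omega>)" by blast
  thus ?thesis using that assms(2) by auto
qed

lemma less_upper_innerE:
  assumes "x < upper_inner_arg \<Omega>" "0 \<le> x"
  obtains \<theta> q where "\<theta> \<in> {0<..pi}" "x < \<theta>" "(+) q ` sector 0 \<theta> \<subseteq> upper_part \<Omega>"
proof -
  have "\<exists>\<theta>\<in>{0} \<union> {\<theta> \<in> {0<..pi}. \<exists>q. (+) q ` sector 0 \<theta> \<subseteq> upper_part \<Omega>}. x < \<theta>"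
    using assms unfolding upper_inner_arg_def
    by (subst (asm) less_cSup_iff) (auto intro!: bdd_aboveI[of _ pi])
  then obtain \<theta> where "x < \<theta>" "\<theta> = 0 \<or> \<theta> \<in> {0<..pi} \<and> (\<exists>q. (+) q ` sector 0 \<theta> \<subseteq> upper_part \<Omega>)" by blast
  thus ?thesis using that assms(2) by auto
qed

lemma lower_outer_candidate: "pi \<in> {\<theta> \<in> {0<..pi}. \<exists>q. lower_part \<Omega> \<subseteq> (+) q ` sector (- \<theta>) 0}"
  by (auto simp: lower_part_def intro!: exI[of _ 0])

lemma upper_outer_candidate: "pi \<in> {\<theta> \<in> {0<..pi}. \<exists>q. upper_part \<Omega> \<subseteq> (+) q ` sector 0 \<theta>}"
  by (auto simp: upper_part_def intro!: exI[of _ 0])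

lemma lower_outer_lessE:
  assumes "lower_outer_arg \<Omega> < x"
  obtains \<theta> q where "\<theta> \<in> {0<..pi}" "\<theta> < x" "lower_part \<Omega> \<subseteq> (+) q ` sector (- \<theta>) 0"
proof -
  have "\<exists>\<theta>\<in>{\<theta> \<in> {0<..pi}. \<exists>q. lower_part \<Omega> \<subseteq> (+) q ` sector (- \<theta>) 0}. \<theta> < x"
    by (rule cInf_lessD[OF _ assms[unfolded lower_outer_arg_def]]) (use lower_outer_candidate in blast)
  thus ?thesis using that by blast
qed

lemma upper_outer_lessE:
  assumes "upper_outer_arg \<Omega> < x"
  obtains \<theta> q where "\<theta> \<in> {0<..pi}" "\<theta> < x" "upper_part \<Omega> \<subseteq> (+) q ` sector 0 \<theta>"
proof -
  have "\<exists>\<theta>\<in>{\<theta> \<in> {0<..pi}. \<exists>q. upper_part \<Omega> \<subseteq> (+) q ` sector 0 \<theta>}. \<theta> < x"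
    by (rule cInf_lessD[OF _ assms[unfolded upper_outer_arg_def]]) (use upper_outer_candidate in blast)
  thus ?thesis using that by blast
qed

lemma lower_inner_le_outer: "lower_inner_arg \<Omega> \<le> lower_outer_arg \<Omega>"
proof (rule ccontr)
  assume "\<not> lower_inner_arg \<Omega> \<le> lower_outer_arg \<Omega>"
  then obtain \<theta>' q' where 1: "\<theta>' \<in> {0<..pi}" "\<theta>' < lower_inner_arg \<Omega>" "lower_part \<Omega> \<subseteq> (+) q' ` sector (- \<theta>') 0"
    by (metis lower_outer_lessE not_le)
  then obtain \<theta> q where 2: "\<theta> \<in> {0<..pi}" "\<theta>' < \<theta>" "(+) q ` sector (- \<theta>) 0 \<subseteq> lower_part \<Omega>"
    using less_lower_innerE[of \<theta>' \<Omega>] by auto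
  show False using lower_sector_subset_le[of q \<theta> q' \<theta>'] 1 2 by force
qed

lemma upper_inner_le_outer: "upper_inner_arg \<Omega> \<le> upper_outer_arg \<Omega>"
proof (rule ccontr)
  assume "\<not> upper_inner_arg \<Omega> \<le> upper_outer_arg \<Omega>"
  then obtain \<theta>' q' where 1: "\<theta>' \<in> {0<..pi}" "\<theta>' < upper_inner_arg \<Omega>" "upper_part \<Omega> \<subseteq> (+) q' ` sector 0 \<theta>'"
    by (metis upper_outer_lessE not_le)
  then obtain \<theta> q where 2: "\<theta> \<in> {0<..pi}" "\<theta>' < \<theta>" "(+) q ` sector 0 \<theta> \<subseteq> upper_part \<Omega>"
    using less_upper_innerE[of \<theta>' \<Omega>] by auto
  show False using upper_sector_subset_le[of q \<theta> q' \<theta>'] 1 2 by force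
qed

section \<open>The direction of the eigenvalues\<close>

lemma Re_i_rcis_times: "Re (\<i> * rcis r \<beta> * x) = - (r * cmod x * sin (Arg x + \<beta>))"
proof -
  have "\<i> * rcis r \<beta> * x = of_real r * (\<i> * (x * cis \<beta>))" by (simp add: rcis_def)
  hence "Re (\<i> * rcis r \<beta> * x) = - (r * Im (x * cis \<beta>))" by (simp add: algebra_simps)
  thus ?thesis unfolding Im_times_cis by (simp only: mult.assoc)
qed

lemma Re_i_rcis_times_cis: "Re (\<i> * rcis r \<beta> * cis t) = - (r * sin (\<beta> + t))"
proof -
  have "rcis r \<beta> * cis t = rcis r (\<beta> + t)" by (simp add: rcis_def cis_mult mult.assoc)
  thus ?thesis by (simp add: mult.assoc)
qed

text \<open>Zero hyperbolic step and connectedness let every horizontal line meet \<open>\<Omega>\<close>, and forward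
  invariance then puts a right half-line of it into \<open>\<Omega>\<close>. Since \<open>\<Omega>\<close> is open, compactness of
  \<open>[Im w0 - R, Im w0 + R]\<close> makes the starting points of these half-lines uniform over a strip. The
  factor \<open>1\<close> in the statement is the direction of the ray.\<close>

lemma (in koenigs_domain) strips_eventually_in_Omega:
  assumes zhs: "zero_hyperbolic_step \<Omega>"
  obtains s0 where "\<And>s. s \<ge> s0 \<Longrightarrow> ball (w0 + of_real s * 1) R \<subseteq> \<Omega>"
proof -
  have onto: "\<exists>x. Complex x y \<in> \<Omega>" for y
  proof -
    have "\<not> \<Omega> \<subseteq> {w. Im w > y}" "\<not> \<Omega> \<subseteq> {w. Im w < y}"
      using zhs by (auto simp: zero_hyperbolic_step_def)
    then obtain a b where "a \<in> \<Omega>" "\<not> Im a > y" "b \<in> \<Omega>" "\<not> Im b < y" by blast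
    hence ab: "a \<in> \<Omega>" "Im a \<le> y" "b \<in> \<Omega>" "Im b \<ge> y" by auto
    have "connected (Im ` \<Omega>)"
      by (intro connected_continuous_image continuous_intros connected_Omega)
    hence "y \<in> Im ` \<Omega>" using ab unfolding connected_iff_interval by blast
    then obtain w where "w \<in> \<Omega>" "y = Im w" by blast
    thus ?thesis by (intro exI[of _ "Re w"]) simp
  qed
  define U where "U n = {y. Complex (real n) y \<in> \<Omega>}" for n
  have "\<exists>N. {Im w0 - R..Im w0 + R} \<subseteq> (\<Union>n\<le>N. U n)"
  proof -
    have "{Im w0 - R..Im w0 + R} \<subseteq> (\<Union>n\<in>UNIV. U n)"
    proof
      fix y
      obtain x where x: "Complex x y \<in> \<Omega>" using onto by blast
      obtain n where n: "x \<le> real n" using real_arch_simple by blast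
      have "Complex x y + of_real (real n - x) \<in> \<Omega>" using n by (intro translate_in_Omega x) simp
      also have "Complex x y + of_real (real n - x) = Complex (real n) y" by (simp add: complex_eq_iff)
      finally show "y \<in> (\<Union>n\<in>UNIV. U n)" by (auto simp: U_def)
    qed
    note cover = this
    have opU: "open (U n)" for n
    proof -
      have "U n = (\<lambda>y. of_real (real n) + \<i> * of_real y) -` \<Omega>" by (auto simp: U_def Complex_eq)
      thus ?thesis by (simp only:) (intro open_vimage open_Omega continuous_intros)
    qed
    obtain D where D: "finite D" "{Im w0 - R..Im w0 + R} \<subseteq> (\<Union>n\<in>D. U n)"
      by (rule compactE_image[OF compact_Icc opU cover])
    have "D \<subseteq> {..Max (insert 0 D)}" using D(1) by auto
    hence "(\<Union>n\<in>D. U n) \<subseteq> (\<Union>n\<le>Max (insert 0 D). U n)" by (intro UN_mono) auto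
    with D(2) have "{Im w0 - R..Im w0 + R} \<subseteq> (\<Union>n\<le>Max (insert 0 D). U n)" by (rule order_trans)
    thus ?thesis ..
  qed
  then obtain N where N: "{Im w0 - R..Im w0 + R} \<subseteq> (\<Union>n\<le>N. U n)" by blast
  show ?thesis
  proof (rule that[of "real N + R - Re w0"], rule subsetI)
    fix s w assume s: "s \<ge> real N + R - Re w0" and w: "w \<in> ball (w0 + of_real s * 1) R"
    hence d: "cmod (w0 + of_real s - w) < R" by (simp add: dist_norm)
    have re: "Re w > real N" using abs_Re_le_cmod[of "w0 + of_real s - w"] d s by simp
    have "\<bar>Im w0 - Im w\<bar> < R" using abs_Im_le_cmod[of "w0 + of_real s - w"] d by simp
    hence "Im w \<in> {Im w0 - R..Im w0 + R}" unfolding atLeastAtMost_iff by linarith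
    then obtain n where n: "n \<le> N" "Complex (real n) (Im w) \<in> \<Omega>" using N by (auto simp: U_def)
    have "Complex (real n) (Im w) + of_real (Re w - real n) \<in> \<Omega>"
      using n re by (intro translate_in_Omega) auto
    also have "Complex (real n) (Im w) + of_real (Re w - real n) = w" by (simp add: complex_eq_iff)
    finally show "w \<in> \<Omega>" .
  qed
qed

context koenigs_space begin

text \<open>Write \<open>\<mu> = i r exp (i \<beta>)\<close>, so that an admissible direction \<open>exp (i t)\<close> says \<open>sin (\<beta> + t) \<ge> 0\<close>.
  The half-strips give \<open>t = 0\<close>, hence \<open>0 \<le> \<beta> \<le> \<pi>\<close>. If \<open>\<beta>\<close> were smaller than the lower inner
  argument, some sector inside \<open>\<Omega>\<close> would contain a direction \<open>exp (- i \<psi>)\<close> with \<open>\<psi>\<close> slightly larger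
  than \<open>\<beta>\<close>; symmetrically for the upper one.\<close>

lemma point_spectrum_arg_bounds:
  assumes zhs: "zero_hyperbolic_step \<Omega>" and \<mu>: "\<mu> \<in> generator_point_spectrum X N \<phi>" "\<mu> \<noteq> 0"
  obtains r \<beta> where "r > 0" "\<mu> = \<i> * rcis r \<beta>" "0 \<le> \<beta>" "\<beta> \<le> pi"
    "lower_inner_arg \<Omega> \<le> \<beta>" "\<beta> \<le> pi - upper_inner_arg \<Omega>"
proof -
  define r where "r = cmod \<mu>"
  define \<beta> where "\<beta> = Arg (- \<i> * \<mu>)"
  have r: "r > 0" using \<mu> by (simp add: r_def)
  have "rcis r \<beta> = - \<i> * \<mu>" using rcis_cmod_Arg[of "- \<i> * \<mu>"] by (simp add: r_def \<beta>_def norm_mult)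
  hence \<mu>_eq: "\<mu> = \<i> * rcis r \<beta>" by simp
  have dir: "sin (\<beta> + t) \<ge> 0" if "\<And>R. R > 0 \<Longrightarrow> \<exists>s0. \<forall>s\<ge>s0. ball (w0 + of_real s * cis t) R \<subseteq> \<Omega>" for t w0
  proof -
    have "Re (\<mu> * cis t) \<le> 0" by (rule spectrum_direction_le[OF \<mu>(1) _ that]) auto
    thus ?thesis using r unfolding \<mu>_eq Re_i_rcis_times_cis by (simp add: zero_le_mult_iff)
  qed
  have "sin (\<beta> + 0) \<ge> 0"
  proof (rule dir[of 0])
    show "\<exists>s0. \<forall>s\<ge>s0. ball (0 + of_real s * cis 0) R \<subseteq> \<Omega>" for R
      using strips_eventually_in_Omega[OF zhs, of 0 R] by (metis cis_zero)
  qed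
  moreover have "- pi < \<beta>" "\<beta> \<le> pi" unfolding \<beta>_def by (rule mpi_less_Arg, rule Arg_le_pi)
  ultimately have \<beta>: "0 \<le> \<beta>" "\<beta> \<le> pi" using sin_gt_zero[of "- \<beta>"] by (auto simp: not_less[symmetric])
  have "lower_inner_arg \<Omega> \<le> \<beta>"
  proof (rule ccontr)
    assume "\<not> lower_inner_arg \<Omega> \<le> \<beta>"
    then obtain \<theta> q where \<theta>: "\<theta> \<in> {0<..pi}" "\<beta> < \<theta>" and sub: "(+) q ` sector (- \<theta>) 0 \<subseteq> lower_part \<Omega>"
      using less_lower_innerE[of \<beta> \<Omega>] \<beta> by auto
    define \<psi> where "\<psi> = (\<beta> + \<theta>) / 2"
    have \<psi>: "0 < \<psi>" "\<beta> < \<psi>" "\<psi> < \<theta>" "\<theta> \<le> pi" using \<theta> \<beta> by (auto simp: \<psi>_def)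
    have "\<exists>s0. \<forall>s\<ge>s0. ball (q + of_real s * cis (- \<psi>)) R \<subseteq> \<Omega>" for R
    proof -
      obtain s0 where "\<And>s. s \<ge> s0 \<Longrightarrow> ball (q + of_real s * cis (- \<psi>)) R \<subseteq> (+) q ` sector (- \<theta>) 0"
        using lower_sector_absorbs_ray[OF \<psi>(1,3,4)] by blast
      thus ?thesis using sub by (intro exI[of _ s0]) (auto simp: lower_part_def)
    qed
    hence "sin (\<beta> + - \<psi>) \<ge> 0" by (rule dir)
    thus False using sin_gt_zero[of "\<psi> - \<beta>"] sin_minus[of "\<psi> - \<beta>"] \<psi> \<beta> by simp
  qed
  moreover have "\<beta> \<le> pi - upper_inner_arg \<Omega>"
  proof (rule ccontr)
    assume "\<not> \<beta> \<le> pi - upper_inner_arg \<Omega>"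
    then obtain \<theta> q where \<theta>: "\<theta> \<in> {0<..pi}" "pi - \<beta> < \<theta>" and sub: "(+) q ` sector 0 \<theta> \<subseteq> upper_part \<Omega>"
      using less_upper_innerE[of "pi - \<beta>" \<Omega>] \<beta> by auto
    define \<psi> where "\<psi> = (pi - \<beta> + \<theta>) / 2"
    have \<psi>: "0 < \<psi>" "pi - \<beta> < \<psi>" "\<psi> < \<theta>" "\<theta> \<le> pi" using \<theta> \<beta> by (auto simp: \<psi>_def field_simps)
    have "\<exists>s0. \<forall>s\<ge>s0. ball (q + of_real s * cis \<psi>) R \<subseteq> \<Omega>" for R
    proof -
      obtain s0 where "\<And>s. s \<ge> s0 \<Longrightarrow> ball (q + of_real s * cis \<psi>) R \<subseteq> (+) q ` sector 0 \<theta>"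
        using upper_sector_absorbs_ray[OF \<psi>(1,3,4)] by blast
      thus ?thesis using sub by (intro exI[of _ s0]) (auto simp: upper_part_def)
    qed
    hence "sin (\<beta> + \<psi>) \<ge> 0" by (rule dir)
    thus False using sin_gt_zero[of "\<beta> + \<psi> - pi"] \<psi> \<beta> by (simp add: sin_diff)
  qed
  ultimately show ?thesis using that[OF r \<mu>_eq \<beta>] by blast
qed

lemma zero_in_point_spectrum: "0 \<in> generator_point_spectrum X N \<phi>"
  unfolding point_spectrum_iff by (rule bounded_mem[where B = 1]) auto

text \<open>A point \<open>x\<close> of a sector with argument in \<open>[- \<beta>, \<pi> - \<beta>]\<close> satisfies \<open>Re (\<mu> x) \<le> 0\<close>, so
  \<open>exp (\<mu> h)\<close> is bounded. The slit hypothesis enters for the real points of \<open>\<Omega>\<close>, which belong to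
  neither half: they are positive.\<close>

lemma point_spectrum_contains:
  assumes slit: "\<Omega> \<subseteq> UNIV - {- of_real t | t. t \<ge> 0}" and r: "r \<ge> 0"
    and \<beta>: "lower_outer_arg \<Omega> < \<beta>" "\<beta> < pi - upper_outer_arg \<Omega>"
  shows "\<i> * rcis r \<beta> \<in> generator_point_spectrum X N \<phi>"
proof -
  define \<mu> where "\<mu> = \<i> * rcis r \<beta>"
  obtain \<theta>1 q1 where 1: "\<theta>1 \<in> {0<..pi}" "\<theta>1 < \<beta>" "lower_part \<Omega> \<subseteq> (+) q1 ` sector (- \<theta>1) 0"
    using lower_outer_lessE[OF \<beta>(1)] by blast
  have "upper_outer_arg \<Omega> < pi - \<beta>" using \<beta>(2) by simp
  then obtain \<theta>2 q2 where 2: "\<theta>2 \<in> {0<..pi}" "\<theta>2 < pi - \<beta>" "upper_part \<Omega> \<subseteq> (+) q2 ` sector 0 \<theta>2"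
    by (rule upper_outer_lessE)
  have cone: "Re (\<mu> * x) \<le> 0" if "0 \<le> Arg x + \<beta>" "Arg x + \<beta> \<le> pi" for x
  proof -
    have "0 \<le> r * cmod x * sin (Arg x + \<beta>)"
      using r sin_ge_zero[OF that] by (intro mult_nonneg_nonneg) auto
    thus ?thesis unfolding \<mu>_def Re_i_rcis_times by linarith
  qed
  have bound: "Re (\<mu> * w) \<le> max (Re (\<mu> * q1)) (max (Re (\<mu> * q2)) 0)" if w: "w \<in> \<Omega>" for w
  proof -
    consider "Im w < 0" | "Im w > 0" | "Im w = 0" by linarith
    thus ?thesis
    proof cases
      assume "Im w < 0"
      hence "w \<in> (+) q1 ` sector (- \<theta>1) 0" using w 1(3) lower_part_iff by blast
      hence "w - q1 \<in> sector (- \<theta>1) 0" by (simp only: translate_image_iff)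
      hence "Re (\<mu> * (w - q1)) \<le> 0" using 1 2 by (intro cone) (auto simp: sector_def)
      thus ?thesis by (simp add: right_diff_distrib)
    next
      assume "Im w > 0"
      hence "w \<in> (+) q2 ` sector 0 \<theta>2" using w 2(3) upper_part_iff by blast
      hence "w - q2 \<in> sector 0 \<theta>2" by (simp only: translate_image_iff)
      hence "Re (\<mu> * (w - q2)) \<le> 0" using 1 2 by (intro cone) (auto simp: sector_def)
      thus ?thesis by (simp add: right_diff_distrib)
    next
      assume "Im w = 0"
      then obtain x where x: "w = of_real x"
        by (metis complex_is_Real_iff Reals_cases)
      have "x > 0"
      proof (rule ccontr)
        assume "\<not> x > 0"
        hence "w = - of_real (- x) \<and> - x \<ge> 0" by (simp add: x)
        thus False using slit w by blast
      qed
      hence "Arg w = 0" by (simp add: x)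
      hence "Re (\<mu> * w) \<le> 0" using 1 2 by (intro cone) auto
      thus ?thesis by simp
    qed
  qed
  have "(\<lambda>z. exp (\<mu> * h z)) \<in> X"
  proof (rule bounded_mem)
    show "(\<lambda>z. exp (\<mu> * h z)) holomorphic_on unit_disk" by (intro holomorphic_intros holo_h)
    show "cmod (exp (\<mu> * h z)) \<le> exp (max (Re (\<mu> * q1)) (max (Re (\<mu> * q2)) 0))" if "z \<in> unit_disk" for z
      using bound[of "h z"] that by (simp add: Omega del: times_complex.sel)
  qed
  thus ?thesis by (simp add: point_spectrum_iff \<mu>_def)
qed

end

text \<open>The closed sector is reached from the open one by letting the argument tend to an end point.\<close>

lemma rcis_in_closure_sector:
  assumes "0 \<le> a" "a < b" "b \<le> pi" "a \<le> \<beta>" "\<beta> \<le> b" "r > 0"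
  shows "rcis r \<beta> \<in> closure (sector a b)"
proof -
  have "rcis r ` closure {a<..<b} \<subseteq> closure (sector a b)"
  proof (rule image_closure_subset)
    show "continuous_on (closure {a<..<b}) (rcis r)" unfolding rcis_def by (intro continuous_intros)
    have "rcis r x \<in> sector a b" if "x \<in> {a<..<b}" for x
      using that assms by (auto simp: sector_def Arg_rcis)
    thus "rcis r ` {a<..<b} \<subseteq> closure (sector a b)" using closure_subset by blast
  qed simp
  thus ?thesis using assms by (auto simp: closure_greaterThanLessThan)
qed

lemma zero_in_closure_sector:
  assumes "0 \<le> a" "a < b" "b \<le> pi"
  shows "0 \<in> closure (sector a b)"
proof -
  have "(\<lambda>r. rcis r ((a + b) / 2)) ` closure {0<..} \<subseteq> closure (sector a b)"
  proof (rule image_closure_subset)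
    show "continuous_on (closure {0<..}) (\<lambda>r. rcis r ((a + b) / 2))"
      unfolding rcis_def by (intro continuous_intros)
    have "rcis r ((a + b) / 2) \<in> sector a b" if "r > 0" for r
      using that assms by (auto simp: sector_def Arg_rcis)
    thus "(\<lambda>r. rcis r ((a + b) / 2)) ` {0<..} \<subseteq> closure (sector a b)" using closure_subset by fastforce
  qed simp
  thus ?thesis by force
qed

context koenigs_space begin

lemma point_spectrum_subset_closure:
  assumes zhs: "zero_hyperbolic_step \<Omega>" and "inner_arg \<Omega> < pi"
  shows "generator_point_spectrum X N \<phi> \<subseteq> (*) \<i> ` closure (sector (lower_inner_arg \<Omega>) (pi - upper_inner_arg \<Omega>))"
proof
  have ab: "0 \<le> lower_inner_arg \<Omega>" "lower_inner_arg \<Omega> < pi - upper_inner_arg \<Omega>" "pi - upper_inner_arg \<Omega> \<le> pi"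
    using assms(2) lower_inner_nonneg[of \<Omega>] upper_inner_nonneg[of \<Omega>] by (auto simp: inner_arg_def)
  fix \<mu> assume \<mu>: "\<mu> \<in> generator_point_spectrum X N \<phi>"
  show "\<mu> \<in> (*) \<i> ` closure (sector (lower_inner_arg \<Omega>) (pi - upper_inner_arg \<Omega>))"
  proof (cases "\<mu> = 0")
    case True
    thus ?thesis using zero_in_closure_sector[OF ab] by (intro image_eqI[of _ _ 0]) auto
  next
    case False
    obtain r \<beta> where "r > 0" "\<mu> = \<i> * rcis r \<beta>" "lower_inner_arg \<Omega> \<le> \<beta>" "\<beta> \<le> pi - upper_inner_arg \<Omega>"
      by (rule point_spectrum_arg_bounds[OF zhs \<mu> False])
    thus ?thesis using rcis_in_closure_sector[OF ab] by blast
  qed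
qed

lemma sector_subset_point_spectrum:
  assumes "\<Omega> \<subseteq> UNIV - {- of_real t | t. t \<ge> 0}"
  shows "(*) \<i> ` sector (lower_outer_arg \<Omega>) (pi - upper_outer_arg \<Omega>) \<union> {0} \<subseteq> generator_point_spectrum X N \<phi>"
proof -
  have "\<i> * w \<in> generator_point_spectrum X N \<phi>" if "w \<in> sector (lower_outer_arg \<Omega>) (pi - upper_outer_arg \<Omega>)" for w
    using point_spectrum_contains[OF assms, of "cmod w" "Arg w"] that by (simp add: sector_def rcis_cmod_Arg)
  thus ?thesis using zero_in_point_spectrum by auto
qed

lemma point_spectrum_inner_pi:
  assumes zhs: "zero_hyperbolic_step \<Omega>" and "inner_arg \<Omega> = pi"
  shows "generator_point_spectrum X N \<phi> \<subseteq> {\<i> * exp (\<i> * of_real (lower_inner_arg \<Omega>)) * of_real t | t. t \<ge> 0}"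
proof
  fix \<mu> assume \<mu>: "\<mu> \<in> generator_point_spectrum X N \<phi>"
  have "\<exists>t\<ge>0. \<mu> = \<i> * rcis t (lower_inner_arg \<Omega>)"
  proof (cases "\<mu> = 0")
    case False
    obtain r \<beta> where "r > 0" "\<mu> = \<i> * rcis r \<beta>" "lower_inner_arg \<Omega> \<le> \<beta>" "\<beta> \<le> pi - upper_inner_arg \<Omega>"
      by (rule point_spectrum_arg_bounds[OF zhs \<mu> False])
    moreover from this have "\<beta> = lower_inner_arg \<Omega>" using assms(2) by (simp add: inner_arg_def)
    ultimately show ?thesis by (intro exI[of _ r]) auto
  qed (auto intro!: exI[of _ 0])
  thus "\<mu> \<in> {\<i> * exp (\<i> * of_real (lower_inner_arg \<Omega>)) * of_real t | t. t \<ge> 0}"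
    by (auto simp: rcis_def cis_conv_exp mult.commute)
qed

lemma point_spectrum_inner_gt_pi:
  assumes zhs: "zero_hyperbolic_step \<Omega>" and "inner_arg \<Omega> > pi"
  shows "generator_point_spectrum X N \<phi> = {0}"
proof -
  have "\<mu> = 0" if \<mu>: "\<mu> \<in> generator_point_spectrum X N \<phi>" for \<mu>
  proof (rule ccontr)
    assume "\<mu> \<noteq> 0"
    then obtain \<beta> where "lower_inner_arg \<Omega> \<le> \<beta>" "\<beta> \<le> pi - upper_inner_arg \<Omega>"
      by (rule point_spectrum_arg_bounds[OF zhs \<mu>])
    thus False using assms(2) by (simp add: inner_arg_def)
  qed
  thus ?thesis using zero_in_point_spectrum by blast
qed

end

theorem theorem1p6:
  fixes \<phi> :: "real \<Rightarrow> complex \<Rightarrow> complex" and h :: "complex \<Rightarrow> complex"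
    and \<Omega> :: "complex set" and p \<alpha> :: real
  assumes "parabolic_semigroup \<phi>"
    and "koenigs_function \<phi> h"
    and "\<Omega> = h ` unit_disk"
    and "zero_hyperbolic_step \<Omega>"
    and "\<Omega> \<subseteq> UNIV - {- of_real t | t. t \<ge> 0}"
    and "p \<ge> 1" and "\<alpha> > -1"
  shows "\<forall>\<sigma> \<in> {bergman_point_spectrum p \<alpha> \<phi>, hardy_point_spectrum p \<phi>}.
     (inner_arg \<Omega> = 0 \<and> outer_arg \<Omega> = 0 \<longrightarrow>
        (*) \<i> ` sector 0 pi \<union> {0} \<subseteq> \<sigma> \<and>
        \<sigma> \<subseteq> (*) \<i> ` closure (sector 0 pi)) \<and>
     (inner_arg \<Omega> = outer_arg \<Omega> \<and> inner_arg \<Omega> \<in> {0<..<pi} \<longrightarrow>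
        lower_inner_arg \<Omega> = lower_outer_arg \<Omega> \<and>
        upper_inner_arg \<Omega> = upper_outer_arg \<Omega> \<and>
        (*) \<i> ` sector (lower_inner_arg \<Omega>) (pi - upper_inner_arg \<Omega>) \<union> {0} \<subseteq> \<sigma> \<and>
        \<sigma> \<subseteq> (*) \<i> ` closure (sector (lower_inner_arg \<Omega>) (pi - upper_inner_arg \<Omega>))) \<and>
     (inner_arg \<Omega> = pi \<longrightarrow>
        \<sigma> \<subseteq> {\<i> * exp (\<i> * of_real (lower_inner_arg \<Omega>)) * of_real t | t. t \<ge> 0}) \<and>
     (inner_arg \<Omega> \<in> {pi<..2 * pi} \<longrightarrow> \<sigma> = {0}) \<and>
     (inner_arg \<Omega> < min pi (outer_arg \<Omega>) \<longrightarrow>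
        (if outer_arg \<Omega> \<ge> pi then {0}
         else (*) \<i> ` sector (lower_outer_arg \<Omega>) (pi - upper_outer_arg \<Omega>) \<union> {0}) \<subseteq> \<sigma> \<and>
        \<sigma> \<subseteq> (if inner_arg \<Omega> = 0 then (*) \<i> ` closure (sector 0 pi)
             else (*) \<i> ` closure (sector (lower_inner_arg \<Omega>) (pi - upper_inner_arg \<Omega>))))"
proof (intro ballI)
  fix \<sigma> assume "\<sigma> \<in> {bergman_point_spectrum p \<alpha> \<phi>, hardy_point_spectrum p \<phi>}"
  then obtain X N where \<sigma>: "\<sigma> = generator_point_spectrum X N \<phi>" and XN: "disk_function_space X N"
    using bergman_disk_function_space[OF assms(6,7)] hardy_disk_function_space[OF assms(6)]
    unfolding bergman_point_spectrum_def hardy_point_spectrum_def by blast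
  have "holomorphic_semigroup \<phi>"
    using assms(1) by (simp add: parabolic_semigroup_def nonelliptic_semigroup_def)
  then interpret koenigs_space \<phi> h \<Omega> X N
    using XN assms(2,3) by (intro koenigs_space.intro koenigs_domain.intro)
  note inner_outer = lower_inner_nonneg[of \<Omega>] upper_inner_nonneg[of \<Omega>]
    lower_inner_le_outer[of \<Omega>] upper_inner_le_outer[of \<Omega>]
  have lower: "(*) \<i> ` sector (lower_outer_arg \<Omega>) (pi - upper_outer_arg \<Omega>) \<union> {0} \<subseteq> \<sigma>"
    unfolding \<sigma> by (rule sector_subset_point_spectrum) fact
  have upper: "\<sigma> \<subseteq> (*) \<i> ` closure (sector (lower_inner_arg \<Omega>) (pi - upper_inner_arg \<Omega>))"
    if "inner_arg \<Omega> < pi"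
    unfolding \<sigma> by (rule point_spectrum_subset_closure[OF assms(4) that])
  have inner0: "lower_inner_arg \<Omega> = 0" "upper_inner_arg \<Omega> = 0" if "inner_arg \<Omega> = 0"
    using that inner_outer by (auto simp: inner_arg_def)
  have outer0: "lower_outer_arg \<Omega> = 0" "upper_outer_arg \<Omega> = 0" if "outer_arg \<Omega> = 0"
    using that inner_outer by (auto simp: outer_arg_def)
  have eq: "lower_inner_arg \<Omega> = lower_outer_arg \<Omega>" "upper_inner_arg \<Omega> = upper_outer_arg \<Omega>"
    if "inner_arg \<Omega> = outer_arg \<Omega>"
    using that inner_outer by (auto simp: inner_arg_def outer_arg_def)
  show "(inner_arg \<Omega> = 0 \<and> outer_arg \<Omega> = 0 \<longrightarrow>
        (*) \<i> ` sector 0 pi \<union> {0} \<subseteq> \<sigma> \<and>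
        \<sigma> \<subseteq> (*) \<i> ` closure (sector 0 pi)) \<and>
     (inner_arg \<Omega> = outer_arg \<Omega> \<and> inner_arg \<Omega> \<in> {0<..<pi} \<longrightarrow>
        lower_inner_arg \<Omega> = lower_outer_arg \<Omega> \<and>
        upper_inner_arg \<Omega> = upper_outer_arg \<Omega> \<and>
        (*) \<i> ` sector (lower_inner_arg \<Omega>) (pi - upper_inner_arg \<Omega>) \<union> {0} \<subseteq> \<sigma> \<and>
        \<sigma> \<subseteq> (*) \<i> ` closure (sector (lower_inner_arg \<Omega>) (pi - upper_inner_arg \<Omega>))) \<and>
     (inner_arg \<Omega> = pi \<longrightarrow>
        \<sigma> \<subseteq> {\<i> * exp (\<i> * of_real (lower_inner_arg \<Omega>)) * of_real t | t. t \<ge> 0}) \<and>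
     (inner_arg \<Omega> \<in> {pi<..2 * pi} \<longrightarrow> \<sigma> = {0}) \<and>
     (inner_arg \<Omega> < min pi (outer_arg \<Omega>) \<longrightarrow>
        (if outer_arg \<Omega> \<ge> pi then {0}
         else (*) \<i> ` sector (lower_outer_arg \<Omega>) (pi - upper_outer_arg \<Omega>) \<union> {0}) \<subseteq> \<sigma> \<and>
        \<sigma> \<subseteq> (if inner_arg \<Omega> = 0 then (*) \<i> ` closure (sector 0 pi)
             else (*) \<i> ` closure (sector (lower_inner_arg \<Omega>) (pi - upper_inner_arg \<Omega>))))"
  proof (intro conjI impI; (elim conjE)?)
    assume 0: "inner_arg \<Omega> = 0" "outer_arg \<Omega> = 0"
    show "(*) \<i> ` sector 0 pi \<union> {0} \<subseteq> \<sigma>" using lower outer0[OF 0(2)] by simp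
    show "\<sigma> \<subseteq> (*) \<i> ` closure (sector 0 pi)" using upper inner0[OF 0(1)] 0(1) by simp
  next
    assume e: "inner_arg \<Omega> = outer_arg \<Omega>" and "inner_arg \<Omega> \<in> {0<..<pi}"
    show "lower_inner_arg \<Omega> = lower_outer_arg \<Omega>" "upper_inner_arg \<Omega> = upper_outer_arg \<Omega>"
      using eq[OF e] by auto
    show "(*) \<i> ` sector (lower_inner_arg \<Omega>) (pi - upper_inner_arg \<Omega>) \<union> {0} \<subseteq> \<sigma>"
      using lower eq[OF e] by simp
    show "\<sigma> \<subseteq> (*) \<i> ` closure (sector (lower_inner_arg \<Omega>) (pi - upper_inner_arg \<Omega>))"
      using upper \<open>inner_arg \<Omega> \<in> {0<..<pi}\<close> by simp
  next
    assume "inner_arg \<Omega> = pi"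
    thus "\<sigma> \<subseteq> {\<i> * exp (\<i> * of_real (lower_inner_arg \<Omega>)) * of_real t | t. t \<ge> 0}"
      unfolding \<sigma> by (rule point_spectrum_inner_pi[OF assms(4)])
  next
    assume "inner_arg \<Omega> \<in> {pi<..2 * pi}"
    thus "\<sigma> = {0}" unfolding \<sigma> by (intro point_spectrum_inner_gt_pi[OF assms(4)]) simp
  next
    assume lt: "inner_arg \<Omega> < min pi (outer_arg \<Omega>)"
    show "(if outer_arg \<Omega> \<ge> pi then {0}
         else (*) \<i> ` sector (lower_outer_arg \<Omega>) (pi - upper_outer_arg \<Omega>) \<union> {0}) \<subseteq> \<sigma>"
      using lower by auto
    show "\<sigma> \<subseteq> (if inner_arg \<Omega> = 0 then (*) \<i> ` closure (sector 0 pi)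
             else (*) \<i> ` closure (sector (lower_inner_arg \<Omega>) (pi - upper_inner_arg \<Omega>)))"
      using upper lt inner0 by (cases "inner_arg \<Omega> = 0") auto
  qed
qed

end
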